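(* Let $s,t\in\mathbb{R}^2$ be two distinct fixed points, let $X_n$ be a homogeneous Poisson point process of intensity $n$ in $\mathbb{R}^2$, and let $X:=X_n\cup\{s,t\}$. Let $\ell(SP_X)$ be the Euclidean length of the shortest path $SP_X$ from $s$ to $t$ in the Delaunay triangulation $\operatorname{Del}(X)$. Then, as $n\to\infty$, $$\mathbb{P}\left[\ell(SP_X)\le (1+2.47\cdot 10^{-11})\,\|s-t\|\right]=O\left(n^{-1/2}\right).$$
   Context: $\|\cdot\|$ is the Euclidean norm. For a locally finite set $\chi\subset\mathbb{R}^2$ in general position (no three points on a line, no four points on a circle), the Delaunay triangulation $\operatorname{Del}(\chi)$ is the set of edges $[x_i,x_j]$, $1\le i\ne j\le 3$, over all triples $x_1,x_2,x_3\in\chi$ whose circumscribed disk contains no point of $\chi$ in its interior. A path between $s,t\in\chi$ in $\operatorname{Del}(\chi)$ is a finite sequence of segments $[Z_0,Z_1],\dots,[Z_{k-1},Z_k]$ with $Z_0=s$, $Z_k=t$, each segment being an edge of $\operatorname{Del}(\chi)$. The shortest path $SP_X$ is the path between $s$ and $t$ in $\operatorname{Del}(X)$ of minimal Euclidean length. The points $s,t$ are fixed (independent of $n$). *)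

theory Defs
  imports "HOL-Probability.Probability"
begin

definition locally_finite :: "'a::metric_space set \<Rightarrow> bool" where
  "locally_finite V \<longleftrightarrow> (\<forall>B. bounded B \<longrightarrow> finite (V \<inter> B))"

(* Only bounded Borel sets B are used, so all counts below are finite and card (X \<omega> \<inter> B) is
   the true number of points.  The explicit Poisson weights also cover null sets B, where
   0 ^ 0 = 1 puts all the mass at k = 0; poisson_pmf requires a positive rate. *)
definition poisson_point_process ::
    "'w measure \<Rightarrow> ('w \<Rightarrow> 'a::euclidean_space set) \<Rightarrow> real \<Rightarrow> bool" where
  "poisson_point_process M X \<mu> \<longleftrightarrow>
     prob_space M \<and>
     (\<forall>\<omega>\<in>space M. locally_finite (X \<omega>)) \<and>
     (\<forall>B\<in>sets borel. bounded B \<longrightarrow>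
        (\<lambda>\<omega>. card (X \<omega> \<inter> B)) \<in> measurable M (count_space UNIV) \<and>
        (\<forall>k. measure M {\<omega> \<in> space M. card (X \<omega> \<inter> B) = k} =
             (\<mu> * measure lborel B) ^ k / fact k * exp (- (\<mu> * measure lborel B)))) \<and>
     (\<forall>(I::nat set) B. finite I \<and> (\<forall>i\<in>I. B i \<in> sets borel \<and> bounded (B i)) \<and>
        disjoint_family_on B I \<longrightarrow>
        prob_space.indep_vars M (\<lambda>_. count_space UNIV) (\<lambda>i \<omega>. card (X \<omega> \<inter> B i)) I)"

(* In the plane, three distinct points have a common circle only if they are not collinear, and
   then c and r are unique: cball c r is the circumscribed disk, with interior ball c r. *)
definition delaunay_triple ::
    "(real^2) set \<Rightarrow> real^2 \<Rightarrow> real^2 \<Rightarrow> real^2 \<Rightarrow> bool" where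
  "delaunay_triple V x y z \<longleftrightarrow>
     {x, y, z} \<subseteq> V \<and> distinct [x, y, z] \<and>
     (\<exists>c r. {x, y, z} \<subseteq> sphere c r \<and> V \<inter> ball c r = {})"

definition Del :: "(real^2) set \<Rightarrow> (real^2) set set" where
  "Del V = {e. \<exists>x y z. delaunay_triple V x y z \<and>
     e \<in> {closed_segment x y, closed_segment y z, closed_segment x z}}"

(* A path is given by its list of vertices Z_0, ..., Z_k. *)
definition del_path :: "(real^2) set \<Rightarrow> real^2 \<Rightarrow> real^2 \<Rightarrow> (real^2) list \<Rightarrow> bool" where
  "del_path V s t Z \<longleftrightarrow>
     Z \<noteq> [] \<and> hd Z = s \<and> last Z = t \<and>
     (\<forall>i. Suc i < length Z \<longrightarrow> closed_segment (Z ! i) (Z ! Suc i) \<in> Del V)"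

definition path_len :: "'a::metric_space list \<Rightarrow> real" where
  "path_len Z = (\<Sum>i<length Z - 1. dist (Z ! i) (Z ! Suc i))"

definition shortest_path :: "(real^2) set \<Rightarrow> real^2 \<Rightarrow> real^2 \<Rightarrow> (real^2) list \<Rightarrow> bool" where
  "shortest_path V s t Z \<longleftrightarrow> is_arg_min path_len (del_path V s t) Z"

lemma Del_edgeD:
  assumes "closed_segment x y \<in> Del V"
  shows "x \<in> V" "y \<in> V" "x \<noteq> y"
  using assms unfolding Del_def delaunay_triple_def
  by (auto simp: closed_segment_eq doubleton_eq_iff)

lemma dist_hd_le_path_len:
  assumes "i < length Z"
  shows "dist (hd Z) (Z ! i) \<le> path_len Z"
proof -
  have "dist (hd Z) (Z ! i) \<le> (\<Sum>j<i. dist (Z ! j) (Z ! Suc j))"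
    using assms
  proof (induction i)
    case 0
    then show ?case by (simp add: hd_conv_nth)
  next
    case (Suc i)
    then show ?case
      using dist_triangle[of "hd Z" "Z ! Suc i" "Z ! i"] by simp
  qed
  also have "\<dots> \<le> path_len Z"
    unfolding path_len_def by (rule sum_mono2) (use assms in auto)
  finally show ?thesis .
qed

(* In a locally finite configuration the minimum is attained whenever s and t are connected. *)
lemma shortest_path_exists:
  assumes "locally_finite V" and "del_path V s t Z0"
  shows "\<exists>Z. shortest_path V s t Z"
proof -
  define L where "L = path_len Z0"
  define F where "F = insert s (V \<inter> cball s L)"
  define D where "D = (\<lambda>(x, y). dist x y) ` {(x, y). x \<in> F \<and> y \<in> F \<and> x \<noteq> y}"
  define d where "d = Min (insert 1 D)"
  have finF: "finite F"
    using assms(1) by (simp add: F_def locally_finite_def)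
  have "finite {(x, y). x \<in> F \<and> y \<in> F \<and> x \<noteq> y}"
    by (rule finite_subset[of _ "F \<times> F"]) (use finF in auto)
  then have finD: "finite (insert 1 D)"
    by (simp add: D_def)
  have dpos: "d > 0"
    unfolding d_def using finD by (subst Min_gr_iff) (auto simp: D_def)
  have dle: "d \<le> dist x y" if "x \<in> F" "y \<in> F" "x \<noteq> y" for x y
    unfolding d_def using finD that by (intro Min_le) (auto simp: D_def)
  define P where "P = {Z. del_path V s t Z \<and> path_len Z \<le> L}"
  define N where "N = nat \<lceil>L / d\<rceil> + 1"
  have sub: "P \<subseteq> {Z. set Z \<subseteq> F \<and> length Z \<le> N}"
  proof
    fix Z assume "Z \<in> P"
    then have Z: "Z \<noteq> []" "hd Z = s" "path_len Z \<le> L"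
      and E: "\<And>i. Suc i < length Z \<Longrightarrow> closed_segment (Z ! i) (Z ! Suc i) \<in> Del V"
      by (auto simp: P_def del_path_def)
    have inF: "Z ! i \<in> F" if "i < length Z" for i
    proof (cases i)
      case 0
      then show ?thesis using Z by (simp add: F_def flip: hd_conv_nth)
    next
      case (Suc j)
      then have "Z ! i \<in> V"
        using E[of j] Del_edgeD(2) that by blast
      then show ?thesis
        using dist_hd_le_path_len[OF that] Z by (simp add: F_def)
    qed
    have "real (length Z - 1) * d = (\<Sum>i<length Z - 1. d)"
      by simp
    also have "\<dots> \<le> path_len Z"
      unfolding path_len_def
      by (intro sum_mono dle inF Del_edgeD(3)[OF E]) auto
    finally have "real (length Z - 1) \<le> L / d"
      using Z(3) dpos by (simp add: field_simps)
    then have "length Z \<le> N"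
      unfolding N_def by linarith
    moreover have "set Z \<subseteq> F"
      using inF by (auto simp: in_set_conv_nth)
    ultimately show "Z \<in> {Z. set Z \<subseteq> F \<and> length Z \<le> N}"
      by simp
  qed
  have finP: "finite P"
    by (rule finite_subset[OF sub finite_lists_length_le[OF finF]])
  have Z0: "Z0 \<in> P"
    using assms(2) by (simp add: P_def L_def)
  obtain Z where Z: "Z \<in> P" "\<And>Z'. Z' \<in> P \<Longrightarrow> path_len Z \<le> path_len Z'"
    using ex_min_if_finite[of "path_len ` P"] finP Z0 by (fastforce simp: not_less)
  have "path_len Z \<le> path_len Z'" if "del_path V s t Z'" for Z'
    using Z(1) Z(2)[of Z'] that by (cases "path_len Z' \<le> L") (auto simp: P_def)
  then show ?thesis
    using Z(1) by (auto simp: shortest_path_def is_arg_min_def P_def not_less)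
qed

end

theory Submission
  imports Defs
begin

text \<open>Cut the region between \<open>s\<close> and \<open>t\<close> into strips of width \<open>w\<close>, of order \<open>n powr (-1/2)\<close>, orthogonal to
  \<open>t - s\<close>. A path that crosses a strip with excess length below \<open>w / 10\<^sup>8\<close> stays in a very thin
  rectangle, so either the rectangle contains a point of the process, or a single Delaunay edge
  crosses the whole strip and half of the disk around this crossing is empty. Both events are
  unlikely, and they are independent for distinct strips. Weighting each strip by the exponential of
  minus its excess length controls both the expensive strips and the entropy of the sequence of rows
  visited: the expected total weight of all row sequences decays like \<open>2\<^sup>-\<^sup>K\<close> for \<open>K\<close> strips, whereas
  a short path forces it to be at least 1.\<close>

subsection \<open>Measurability\<close>

text \<open>The obstacle is that the rows visited by a short path depend on the configuration,
  whereas probabilities can be computed only for rows fixed in advance. Hence the sum over all row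
  sequences, and the need to charge every change of row to excess length. The scales are linked: an
  excess of \<open>w / 10^8\<close> allows a height of order \<open>w / 10^4\<close>, so rows have
  that height. A rectangle four rows high then holds at most 0.0144 points on average if
  \<open>n * w\<^sup>2 \<le> 36\<close>, while each large rectangle beside it is empty with
  probability at most \<open>exp (- 5)\<close> if \<open>25 \<le> n * w\<^sup>2\<close>. Per strip,
  row changes contribute a factor 10 and the process a factor 1/20. With these weights the average
  excess per strip may be 1/40 of the unit \<open>w / (5 * 10^8)\<close> times one; the constant
  \<open>2.47 / 10^11\<close> amounts to 0.01235 units. The bound obtained is exponentially small in
  \<open>sqrt n\<close>, and the power of \<open>n\<close> is a weakening of it.\<close>

lemma measurable_enumeration:
  fixes X :: "'w \<Rightarrow> 'a::euclidean_space set"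
  assumes lf: "\<And>\<omega>. \<omega> \<in> space M \<Longrightarrow> locally_finite (X \<omega>)"
    and meas: "\<And>B. B \<in> sets borel \<Longrightarrow> bounded B \<Longrightarrow>
                 (\<lambda>\<omega>. card (X \<omega> \<inter> B)) \<in> measurable M (count_space UNIV)"
  shows "\<exists>\<xi> :: nat \<Rightarrow> 'w \<Rightarrow> 'a. (\<forall>k. \<xi> k \<in> borel_measurable M) \<and>
           (\<forall>\<omega>\<in>space M. range (\<lambda>k. \<xi> k \<omega>) = insert s (X \<omega>))"
proof -
  obtain \<B> :: "'a set set" where \<B>: "countable \<B>" "topological_basis \<B>"
    using ex_countable_basis by blast
  \<comment> \<open>Counts are measurable on bounded sets only; the empty set makes the fallback
    value \<open>s\<close> occur in the enumeration.\<close>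
  define \<C> where "\<C> = insert {} {B \<in> \<B>. bounded B}"
  have \<C>: "countable \<C>" "\<C> \<noteq> {}" using \<B>(1) by (auto simp: \<C>_def)
  define C where "C = from_nat_into \<C>"
  have rangeC: "range C = \<C>" unfolding C_def using \<C> by (simp add: range_from_nat_into)
  have C: "C k \<in> sets borel" "bounded (C k)" for k
  proof -
    have "C k \<in> \<C>" using rangeC by blast
    then show "C k \<in> sets borel" "bounded (C k)"
      using topological_basis_open[OF \<B>(2)] by (auto simp: \<C>_def)
  qed
  \<comment> \<open>A point is read off from a basic set that contains no other. Whether it lies in
    \<open>B\<close> is decided by the count on \<open>C k \<inter> B\<close>, which gives
    measurability; local finiteness isolates every point in some \<open>C k\<close>, which gives
    surjectivity.\<close>
  define \<xi> where "\<xi> k \<omega> = (if card (X \<omega> \<inter> C k) = 1 then the_elem (X \<omega> \<inter> C k) else s)" for k \<omega>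
  show ?thesis
  proof (intro exI[of _ \<xi>] conjI allI ballI)
    fix k
    show "\<xi> k \<in> borel_measurable M"
    proof (rule measurableI)
      fix B :: "'a set" assume B: "B \<in> sets borel"
      have m1: "(\<lambda>\<omega>. card (X \<omega> \<inter> C k)) \<in> measurable M (count_space UNIV)"
        using meas C by blast
      have "(\<lambda>\<omega>. card (X \<omega> \<inter> (C k \<inter> B))) \<in> measurable M (count_space UNIV)"
        using C B by (intro meas) (auto intro: bounded_subset)
      note m2 = this
      have "card (X \<omega> \<inter> (C k \<inter> B)) = 1 \<longleftrightarrow> the_elem (X \<omega> \<inter> C k) \<in> B"
        if one: "card (X \<omega> \<inter> C k) = 1" for \<omega>
      proof -
        obtain x where x: "X \<omega> \<inter> C k = {x}" using one by (auto simp: card_1_singleton_iff)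
        then have "X \<omega> \<inter> (C k \<inter> B) = (if x \<in> B then {x} else {})" by auto
        then show ?thesis using x by simp
      qed
      then have eq: "\<xi> k -` B \<inter> space M =
          {\<omega> \<in> space M. card (X \<omega> \<inter> C k) = 1 \<and> card (X \<omega> \<inter> (C k \<inter> B)) = 1 \<or>
             card (X \<omega> \<inter> C k) \<noteq> 1 \<and> s \<in> B}"
        by (auto simp: \<xi>_def split: if_splits)
      show "\<xi> k -` B \<inter> space M \<in> sets M"
        unfolding eq using m1 m2 by measurable
    qed simp
  next
    fix \<omega> assume \<omega>: "\<omega> \<in> space M"
    have "\<xi> k \<omega> \<in> insert s (X \<omega>)" for k
    proof (cases "card (X \<omega> \<inter> C k) = 1")
      case True
      then obtain x where x: "X \<omega> \<inter> C k = {x}" by (auto simp: card_1_singleton_iff)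
      then have "\<xi> k \<omega> = x" by (simp add: \<xi>_def)
      then show ?thesis using x by auto
    qed (simp add: \<xi>_def)
    moreover have "x \<in> range (\<lambda>k. \<xi> k \<omega>)" if x: "x \<in> X \<omega>" for x
    proof -
      have fin: "finite (X \<omega> \<inter> ball x 1)"
        using lf[OF \<omega>] by (simp add: locally_finite_def)
      define U where "U = ball x 1 - (X \<omega> \<inter> ball x 1 - {x})"
      have "open U" unfolding U_def using fin by (intro open_Diff finite_imp_closed) auto
      moreover have "x \<in> U" by (simp add: U_def)
      ultimately obtain B where B: "B \<in> \<B>" "x \<in> B" "B \<subseteq> U"
        using topological_basisE[OF \<B>(2)] by metis
      have "bounded B" using B(3) by (auto simp: U_def intro: bounded_subset[OF bounded_ball])
      then have "B \<in> \<C>" using B by (simp add: \<C>_def)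
      then obtain k where k: "B = C k" using rangeC by blast
      have "X \<omega> \<inter> C k = {x}" using B x unfolding k[symmetric] U_def by auto
      then have "\<xi> k \<omega> = x" by (simp add: \<xi>_def)
      then show ?thesis by blast
    qed
    moreover have "s \<in> range (\<lambda>k. \<xi> k \<omega>)"
    proof -
      have "{} \<in> range C" using rangeC by (simp add: \<C>_def)
      then obtain k where k: "C k = {}" by (metis imageE)
      then have "\<xi> k \<omega> = s" by (simp add: \<xi>_def)
      then show ?thesis by blast
    qed
    ultimately show "range (\<lambda>k. \<xi> k \<omega>) = insert s (X \<omega>)" by blast
  qed
qed

text \<open>\<open>(circ1, circ2)\<close> is the circumcentre by Cramer's rule, a junk value when \<open>tri_det\<close> vanishes.
  Explicit formulas make the Delaunay condition measurable in the points.\<close>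

definition tri_det :: "real^2 \<Rightarrow> real^2 \<Rightarrow> real^2 \<Rightarrow> real" where
  "tri_det x y z = (y$1 - x$1) * (z$2 - x$2) - (y$2 - x$2) * (z$1 - x$1)"

definition circ1 :: "real^2 \<Rightarrow> real^2 \<Rightarrow> real^2 \<Rightarrow> real" where
  "circ1 x y z = x$1 + (((y$1 - x$1)\<^sup>2 + (y$2 - x$2)\<^sup>2) * (z$2 - x$2) -
     ((z$1 - x$1)\<^sup>2 + (z$2 - x$2)\<^sup>2) * (y$2 - x$2)) / (2 * tri_det x y z)"

definition circ2 :: "real^2 \<Rightarrow> real^2 \<Rightarrow> real^2 \<Rightarrow> real" where
  "circ2 x y z = x$2 + (((z$1 - x$1)\<^sup>2 + (z$2 - x$2)\<^sup>2) * (y$1 - x$1) -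
     ((y$1 - x$1)\<^sup>2 + (y$2 - x$2)\<^sup>2) * (z$1 - x$1)) / (2 * tri_det x y z)"

text \<open>Cramer's rule after moving \<open>x\<close> to the origin: \<open>(a, b)\<close> and
  \<open>(e, f)\<close> are the other two vertices, \<open>(p, q)\<close> is the centre. From left
  to right, \<open>D \<noteq> 0\<close> expresses that distinct points on a circle are not
  collinear.\<close>

lemma circle_system_iff:
  fixes a b e f p q D :: real
  assumes "D = a * f - b * e" 
  shows "(a,b) \<noteq> (0,0) \<and> (e,f) \<noteq> (0,0) \<and> (a,b) \<noteq> (e,f) \<and>
      2 * (a * p + b * q) = a\<^sup>2 + b\<^sup>2 \<and> 2 * (e * p + f * q) = e\<^sup>2 + f\<^sup>2 \<longleftrightarrow>
     D \<noteq> 0 \<and> p = ((a\<^sup>2 + b\<^sup>2) * f - (e\<^sup>2 + f\<^sup>2) * b) / (2 * D) \<and>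
     q = ((e\<^sup>2 + f\<^sup>2) * a - (a\<^sup>2 + b\<^sup>2) * e) / (2 * D)" (is "?L \<longleftrightarrow> ?R")
proof
  assume L: ?L
  then have h: "2 * (a * p + b * q) = a\<^sup>2 + b\<^sup>2" "2 * (e * p + f * q) = e\<^sup>2 + f\<^sup>2"
    by auto
  have 1: "2 * D * p = (a\<^sup>2 + b\<^sup>2) * f - (e\<^sup>2 + f\<^sup>2) * b"
    using h unfolding assms by algebra
  have 2: "2 * D * q = (e\<^sup>2 + f\<^sup>2) * a - (a\<^sup>2 + b\<^sup>2) * e"
    using h unfolding assms by algebra
  have "D \<noteq> 0"
  proof
    assume D: "D = 0"
    define A where "A = a\<^sup>2 + b\<^sup>2"
    define C where "C = e\<^sup>2 + f\<^sup>2"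
    have A: "A > 0" and C: "C > 0"
      using L by (auto simp: A_def C_def sum_power2_gt_zero_iff)
    \<comment> \<open>The vector \<open>(e, f)\<close> scaled by \<open>A\<close> equals
      \<open>(a, b)\<close> scaled by \<open>C\<close>. Since \<open>A\<close> and \<open>C\<close>
      are the squared lengths of \<open>(a, b)\<close> and \<open>(e, f)\<close>, taking norms
      forces \<open>A = C\<close>.\<close>
    have e1: "A * f = C * b" "C * a = A * e" using 1 2 D by (auto simp: A_def C_def)
    have "C * (C * A) = (C*a)\<^sup>2 + (C*b)\<^sup>2" by (simp add: A_def power_mult_distrib) algebra
    also have "\<dots> = A * A * C" using e1 by (simp add: C_def power_mult_distrib flip: e1(1)) algebra
    finally have "C = A" using A C by simp
    then have "a = e" "b = f" using e1 A by auto
    then show False using L by simp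
  qed
  then show ?R using 1 2 by (simp add: field_simps)
next
  assume R: ?R
  then have D: "D \<noteq> 0" by simp
  have "2 * D * p = (a\<^sup>2 + b\<^sup>2) * f - (e\<^sup>2 + f\<^sup>2) * b"
    and "2 * D * q = (e\<^sup>2 + f\<^sup>2) * a - (a\<^sup>2 + b\<^sup>2) * e"
    using R by (auto simp: field_simps)
  then have "D * (2 * (a * p + b * q)) = D * (a\<^sup>2 + b\<^sup>2)"
    and "D * (2 * (e * p + f * q)) = D * (e\<^sup>2 + f\<^sup>2)"
    unfolding assms by (algebra, algebra)
  then show ?L using D unfolding assms by auto
qed

text \<open>The circle through three points is unique, so the quantifiers over \<open>c\<close> and
  \<open>r\<close> disappear. What remains is one inequality between coordinates for each point of
  \<open>V\<close>, measurable once \<open>V\<close> is enumerated.\<close>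

lemma delaunay_triple_iff:
  "delaunay_triple V x y z \<longleftrightarrow> {x, y, z} \<subseteq> V \<and> tri_det x y z \<noteq> 0 \<and>
     (\<forall>v\<in>V. (x$1 - circ1 x y z)\<^sup>2 + (x$2 - circ2 x y z)\<^sup>2 \<le>
            (v$1 - circ1 x y z)\<^sup>2 + (v$2 - circ2 x y z)\<^sup>2)"
proof -
  have d2: "(dist a b)\<^sup>2 = (a$1 - b$1)\<^sup>2 + (a$2 - b$2)\<^sup>2" for a b :: "real^2"
    by (simp add: dist_norm norm_vec_def L2_set_def sum_2)
  have deq: "dist a b = dist e f \<longleftrightarrow> (dist a b)\<^sup>2 = (dist e f)\<^sup>2" for a b e f :: "real^2"
    by simp
  have dle: "dist a b \<le> dist e f \<longleftrightarrow> (dist a b)\<^sup>2 \<le> (dist e f)\<^sup>2" for a b e f :: "real^2"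
    by (simp add: power2_le_iff_abs_le)
  have key: "distinct [x, y, z] \<and> dist c x = dist c y \<and> dist c x = dist c z \<longleftrightarrow>
      tri_det x y z \<noteq> 0 \<and> c$1 = circ1 x y z \<and> c$2 = circ2 x y z" for c
  proof -
    have "distinct [x, y, z] \<and> dist c x = dist c y \<and> dist c x = dist c z \<longleftrightarrow>
      (y$1 - x$1, y$2 - x$2) \<noteq> (0,0) \<and> (z$1 - x$1, z$2 - x$2) \<noteq> (0,0) \<and>
      (y$1 - x$1, y$2 - x$2) \<noteq> (z$1 - x$1, z$2 - x$2) \<and>
      2 * ((y$1 - x$1) * (c$1 - x$1) + (y$2 - x$2) * (c$2 - x$2)) = (y$1 - x$1)\<^sup>2 + (y$2 - x$2)\<^sup>2 \<and>
      2 * ((z$1 - x$1) * (c$1 - x$1) + (z$2 - x$2) * (c$2 - x$2)) = (z$1 - x$1)\<^sup>2 + (z$2 - x$2)\<^sup>2"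
      unfolding deq d2 by (auto simp: vec_eq_iff forall_2 power2_eq_square algebra_simps)
    also have "\<dots> \<longleftrightarrow> tri_det x y z \<noteq> 0 \<and> c$1 = circ1 x y z \<and> c$2 = circ2 x y z"
      by (subst circle_system_iff[OF tri_det_def]) (auto simp: circ1_def circ2_def)
    finally show ?thesis .
  qed
  show ?thesis
  proof
    assume L: "delaunay_triple V x y z"
    then obtain c r where c: "{x, y, z} \<subseteq> sphere c r" "V \<inter> ball c r = {}"
      by (auto simp: delaunay_triple_def)
    then have r: "dist c x = r" "dist c y = r" "dist c z = r" by auto
    then have k: "tri_det x y z \<noteq> 0" "c$1 = circ1 x y z" "c$2 = circ2 x y z"
      using L key[of c] by (auto simp: delaunay_triple_def)
    have "dist x c \<le> dist v c" if "v \<in> V" for v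
      using c(2) r that by (force simp: dist_commute)
    then show "{x, y, z} \<subseteq> V \<and> tri_det x y z \<noteq> 0 \<and>
     (\<forall>v\<in>V. (x$1 - circ1 x y z)\<^sup>2 + (x$2 - circ2 x y z)\<^sup>2 \<le>
            (v$1 - circ1 x y z)\<^sup>2 + (v$2 - circ2 x y z)\<^sup>2)"
      using L k by (auto simp: delaunay_triple_def dle d2)
  next
    assume R: "{x, y, z} \<subseteq> V \<and> tri_det x y z \<noteq> 0 \<and>
     (\<forall>v\<in>V. (x$1 - circ1 x y z)\<^sup>2 + (x$2 - circ2 x y z)\<^sup>2 \<le>
            (v$1 - circ1 x y z)\<^sup>2 + (v$2 - circ2 x y z)\<^sup>2)"
    define c :: "real^2" where "c = vector [circ1 x y z, circ2 x y z]"
    have cc: "c$1 = circ1 x y z" "c$2 = circ2 x y z" by (auto simp: c_def)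
    have k: "distinct [x, y, z]" "dist c y = dist c x" "dist c z = dist c x"
      using key[of c] cc R by auto
    have "dist x c \<le> dist v c" if "v \<in> V" for v
      using R that unfolding dle d2 cc by blast
    then have "V \<inter> ball c (dist c x) = {}" by (force simp: dist_commute)
    then show "delaunay_triple V x y z"
      using R k unfolding delaunay_triple_def by (intro conjI exI[of _ c] exI[of _ "dist c x"]) auto
  qed
qed

lemma Del_edge_iff:
  "closed_segment x y \<in> Del V \<longleftrightarrow> (\<exists>z. delaunay_triple V x y z)"
proof
  assume "closed_segment x y \<in> Del V"
  then obtain a b c where t: "delaunay_triple V a b c" and
    e: "closed_segment x y \<in> {closed_segment a b, closed_segment b c, closed_segment a c}"
    by (auto simp: Del_def)
  have perm: "delaunay_triple V a b c" "delaunay_triple V b a c" "delaunay_triple V b c a"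
    "delaunay_triple V c b a" "delaunay_triple V a c b" "delaunay_triple V c a b"
    using t unfolding delaunay_triple_def by (auto simp: insert_commute)
  show "\<exists>z. delaunay_triple V x y z"
    using e perm by (auto simp: closed_segment_eq doubleton_eq_iff)
qed (auto simp: Del_def)

text \<open>Trades minimality among all paths for the existence of one short path, which is a
  countable union once vertices are indexed by numbers.\<close>

lemma ex_shortest_path_le_iff:
  assumes "locally_finite V"
  shows "(\<exists>Z. shortest_path V s t Z \<and> path_len Z \<le> L) \<longleftrightarrow> (\<exists>Z. del_path V s t Z \<and> path_len Z \<le> L)"
proof
  assume "\<exists>Z. del_path V s t Z \<and> path_len Z \<le> L"
  then obtain Z where Z: "del_path V s t Z" "path_len Z \<le> L" by blast
  obtain Z' where Z': "shortest_path V s t Z'"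
    using shortest_path_exists[OF assms Z(1)] by blast
  then have "path_len Z' \<le> path_len Z"
    using Z(1) by (auto simp: shortest_path_def is_arg_min_def not_less)
  then show "\<exists>Z. shortest_path V s t Z \<and> path_len Z \<le> L"
    using Z' Z(2) by (intro exI[of _ Z']) linarith
qed (auto simp: shortest_path_def is_arg_min_def)

lemma locally_finite_Un: "locally_finite V \<Longrightarrow> finite F \<Longrightarrow> locally_finite (V \<union> F)"
  by (auto simp: locally_finite_def Int_Un_distrib2)

lemma del_path_nth_mem:
  assumes "del_path V s t Z" "s \<in> V" "i < length Z"
  shows "Z ! i \<in> V"
proof (cases i)
  case 0
  have "Z ! 0 = s" using assms(1) by (simp add: del_path_def flip: hd_conv_nth)
  then show ?thesis using assms(2) 0 by metis
next
  case (Suc j)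
  then have "closed_segment (Z ! j) (Z ! i) \<in> Del V"
    using assms(1,3) unfolding del_path_def by metis
  then show ?thesis by (rule Del_edgeD)
qed

lemma sets_ex_shortest_path_le:
  fixes X :: "'w \<Rightarrow> (real^2) set"
  assumes lf: "\<And>\<omega>. \<omega> \<in> space M \<Longrightarrow> locally_finite (X \<omega>)"
    and meas: "\<And>B. B \<in> sets borel \<Longrightarrow> bounded B \<Longrightarrow>
                 (\<lambda>\<omega>. card (X \<omega> \<inter> B)) \<in> measurable M (count_space UNIV)"
  shows "{\<omega> \<in> space M. \<exists>Z. shortest_path (X \<omega> \<union> {s, t}) s t Z \<and> path_len Z \<le> L} \<in> sets M"
proof -
  have "\<exists>\<zeta> :: nat \<Rightarrow> 'w \<Rightarrow> real^2. (\<forall>k. \<zeta> k \<in> borel_measurable M) \<and>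
           (\<forall>\<omega>\<in>space M. range (\<lambda>k. \<zeta> k \<omega>) = insert s (X \<omega>))"
    by (intro measurable_enumeration lf meas)
  then obtain \<zeta> :: "nat \<Rightarrow> 'w \<Rightarrow> real^2" where \<zeta>: "\<forall>k. \<zeta> k \<in> borel_measurable M"
    "\<forall>\<omega>\<in>space M. range (\<lambda>k. \<zeta> k \<omega>) = insert s (X \<omega>)"
    by (elim exE conjE)
  \<comment> \<open>\<open>\<zeta>\<close> covers only \<open>X \<omega>\<close> and
    \<open>s\<close>; index 0 adds \<open>t\<close>.\<close>
  define \<xi> where "\<xi> k = (case k of 0 \<Rightarrow> (\<lambda>_. t) | Suc k \<Rightarrow> \<zeta> k)" for k
  have [measurable]: "\<xi> k \<in> borel_measurable M" for k
    using \<zeta>(1) by (auto simp: \<xi>_def split: nat.split)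
  have V: "X \<omega> \<union> {s, t} = range (\<lambda>k. \<xi> k \<omega>)" if "\<omega> \<in> space M" for \<omega>
  proof -
    have "range (\<lambda>k. \<xi> k \<omega>) = insert t (range (\<lambda>k. \<zeta> k \<omega>))"
      by (subst UNIV_nat_eq) (simp add: \<xi>_def image_image)
    then show ?thesis using bspec[OF \<zeta>(2) that] by auto
  qed
  have comp_meas [measurable]: "(\<lambda>\<omega>. \<xi> k \<omega> $ i) \<in> borel_measurable M" for k i
    by (rule measurable_compose[of "\<xi> k" M borel])
       (auto intro!: borel_measurable_continuous_onI linear_continuous_on bounded_linear_vec_nth)
  define edge where "edge i j \<omega> \<longleftrightarrow> (\<exists>k. tri_det (\<xi> i \<omega>) (\<xi> j \<omega>) (\<xi> k \<omega>) \<noteq> 0 \<and>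
     (\<forall>l. (\<xi> i \<omega>$1 - circ1 (\<xi> i \<omega>) (\<xi> j \<omega>) (\<xi> k \<omega>))\<^sup>2 + (\<xi> i \<omega>$2 - circ2 (\<xi> i \<omega>) (\<xi> j \<omega>) (\<xi> k \<omega>))\<^sup>2 \<le>
          (\<xi> l \<omega>$1 - circ1 (\<xi> i \<omega>) (\<xi> j \<omega>) (\<xi> k \<omega>))\<^sup>2 + (\<xi> l \<omega>$2 - circ2 (\<xi> i \<omega>) (\<xi> j \<omega>) (\<xi> k \<omega>))\<^sup>2))" for i j \<omega>
  have tri_meas [measurable]: "(\<lambda>\<omega>. tri_det (\<xi> i \<omega>) (\<xi> j \<omega>) (\<xi> k \<omega>)) \<in> borel_measurable M" for i j k
    unfolding tri_det_def by measurable
  have [measurable]: "(\<lambda>\<omega>. circ1 (\<xi> i \<omega>) (\<xi> j \<omega>) (\<xi> k \<omega>)) \<in> borel_measurable M"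
    "(\<lambda>\<omega>. circ2 (\<xi> i \<omega>) (\<xi> j \<omega>) (\<xi> k \<omega>)) \<in> borel_measurable M" for i j k
    unfolding circ1_def circ2_def
    by (intro borel_measurable_add borel_measurable_divide borel_measurable_diff borel_measurable_times
          borel_measurable_power borel_measurable_const tri_meas comp_meas)+
  have edge_meas [measurable]: "Measurable.pred M (edge i j)" for i j
    unfolding edge_def by measurable
  have edge: "closed_segment (\<xi> i \<omega>) (\<xi> j \<omega>) \<in> Del (X \<omega> \<union> {s, t}) \<longleftrightarrow> edge i j \<omega>"
    if "\<omega> \<in> space M" for i j \<omega>
    unfolding Del_edge_iff delaunay_triple_iff edge_def V[OF that] by auto
  \<comment> \<open>Paths become finite lists of indices, of which there are countably many.\<close>
  have iff: "(\<exists>Z. shortest_path (X \<omega> \<union> {s, t}) s t Z \<and> path_len Z \<le> L) \<longleftrightarrow>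
     (\<exists>is. is \<noteq> [] \<and> \<xi> (hd is) \<omega> = s \<and> \<xi> (last is) \<omega> = t \<and>
        (\<forall>i. Suc i < length is \<longrightarrow> edge (is ! i) (is ! Suc i) \<omega>) \<and>
        (\<Sum>i<length is - 1. dist (\<xi> (is ! i) \<omega>) (\<xi> (is ! Suc i) \<omega>)) \<le> L)" (is "?A \<longleftrightarrow> ?B")
    if \<omega>: "\<omega> \<in> space M" for \<omega>
  proof -
    have "?A \<longleftrightarrow> (\<exists>Z. del_path (X \<omega> \<union> {s, t}) s t Z \<and> path_len Z \<le> L)"
      by (intro ex_shortest_path_le_iff locally_finite_Un lf \<omega>) auto
    also have "\<dots> \<longleftrightarrow> (\<exists>is. del_path (X \<omega> \<union> {s, t}) s t (map (\<lambda>k. \<xi> k \<omega>) is) \<and>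
                 path_len (map (\<lambda>k. \<xi> k \<omega>) is) \<le> L)"
    proof
      assume "\<exists>Z. del_path (X \<omega> \<union> {s, t}) s t Z \<and> path_len Z \<le> L"
      then obtain Z where Z: "del_path (X \<omega> \<union> {s, t}) s t Z" "path_len Z \<le> L" by blast
      have "set Z \<subseteq> X \<omega> \<union> {s, t}"
        using del_path_nth_mem[OF Z(1)] unfolding in_set_conv_nth subset_iff by fastforce
      then have "set Z \<subseteq> range (\<lambda>k. \<xi> k \<omega>)" using V[OF \<omega>] by blast
      then have "Z \<in> lists (range (\<lambda>k. \<xi> k \<omega>))" by auto
      then obtain "is" where "Z = map (\<lambda>k. \<xi> k \<omega>) is"
        unfolding lists_image by auto
      then show "\<exists>is. del_path (X \<omega> \<union> {s, t}) s t (map (\<lambda>k. \<xi> k \<omega>) is) \<and>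
                 path_len (map (\<lambda>k. \<xi> k \<omega>) is) \<le> L" using Z by blast
    qed blast
    also have "\<dots> \<longleftrightarrow> ?B"
      unfolding del_path_def path_len_def
      by (intro arg_cong[where f=Ex] ext) (simp add: hd_map last_map edge[OF \<omega>] del: Un_insert_right cong: conj_cong)
    finally show ?thesis .
  qed
  have "{\<omega> \<in> space M. \<exists>is. is \<noteq> [] \<and> \<xi> (hd is) \<omega> = s \<and> \<xi> (last is) \<omega> = t \<and>
        (\<forall>i. Suc i < length is \<longrightarrow> edge (is ! i) (is ! Suc i) \<omega>) \<and>
        (\<Sum>i<length is - 1. dist (\<xi> (is ! i) \<omega>) (\<xi> (is ! Suc i) \<omega>)) \<le> L} \<in> sets M"
    by measurable
  then show ?thesis using iff by (simp cong: conj_cong)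
qed

subsection \<open>Geometry of cheap strips\<close>

definition polyline :: "'a::real_normed_vector list \<Rightarrow> nat \<Rightarrow> real \<Rightarrow> 'a" where
  "polyline Z m \<theta> = Z ! m + \<theta> *\<^sub>R (Z ! Suc m - Z ! m)"

definition arc_length :: "'a::real_normed_vector list \<Rightarrow> nat \<Rightarrow> real \<Rightarrow> real" where
  "arc_length Z m \<theta> = (\<Sum>j<m. dist (Z ! j) (Z ! Suc j)) + \<theta> * dist (Z ! m) (Z ! Suc m)"

lemma dist_nth_le_sum:
  fixes Z :: "'a::metric_space list"
  assumes "a \<le> b"
  shows "dist (Z ! a) (Z ! b) \<le> (\<Sum>j<b. dist (Z ! j) (Z ! Suc j)) - (\<Sum>j<a. dist (Z ! j) (Z ! Suc j))"
  using assms
proof (induction rule: dec_induct)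
  case (step b)
  then show ?case using dist_triangle[of "Z ! a" "Z ! Suc b" "Z ! b"] by simp
qed simp

lemma dist_polyline:
  "dist (polyline Z m \<theta>) (polyline Z m \<theta>') = \<bar>\<theta>' - \<theta>\<bar> * dist (Z ! m) (Z ! Suc m)"
proof -
  have "polyline Z m \<theta> - polyline Z m \<theta>' = (\<theta> - \<theta>') *\<^sub>R (Z ! Suc m - Z ! m)"
    by (simp add: polyline_def algebra_simps)
  then show ?thesis by (simp add: dist_norm norm_minus_commute abs_minus_commute)
qed

lemma polyline_0 [simp]: "polyline Z m 0 = Z ! m" and polyline_1: "polyline Z m 1 = Z ! Suc m"
  by (simp_all add: polyline_def)

lemma polyline_in_segment:
  "0 \<le> \<theta> \<Longrightarrow> \<theta> \<le> 1 \<Longrightarrow> polyline Z m \<theta> \<in> closed_segment (Z ! m) (Z ! Suc m)"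
  by (auto simp: closed_segment_def polyline_def algebra_simps intro!: exI[of _ \<theta>])

text \<open>Keeping the vertex \<open>Z ! Suc m\<close> in the bound, instead of cutting it off,
  lets a process point inside a strip appear as a detour of controlled length.\<close>

lemma dist_via_vertex_le_arc_length:
  assumes "m < m'" "\<theta> \<le> 1" "0 \<le> \<theta>'"
  shows "dist (polyline Z m \<theta>) (Z ! Suc m) + dist (Z ! Suc m) (polyline Z m' \<theta>')
           \<le> arc_length Z m' \<theta>' - arc_length Z m \<theta>"
proof -
  have "dist (polyline Z m \<theta>) (Z ! Suc m) = (1 - \<theta>) * dist (Z ! m) (Z ! Suc m)"
    using dist_polyline[of Z m \<theta> 1] assms by (simp add: polyline_1)
  moreover have "dist (Z ! m') (polyline Z m' \<theta>') = \<theta>' * dist (Z ! m') (Z ! Suc m')"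
    using dist_polyline[of Z m' 0 \<theta>'] assms by simp
  moreover have "dist (Z ! Suc m) (Z ! m') \<le>
     (\<Sum>j<m'. dist (Z ! j) (Z ! Suc j)) - (\<Sum>j<Suc m. dist (Z ! j) (Z ! Suc j))"
    using assms by (intro dist_nth_le_sum) auto
  ultimately show ?thesis
    using dist_triangle[of "Z ! Suc m" "polyline Z m' \<theta>'" "Z ! m'"]
    by (simp add: arc_length_def algebra_simps)
qed

lemma dist_polyline_le_arc_length:
  assumes "m < m' \<or> m = m' \<and> \<theta> \<le> \<theta>'" "\<theta> \<le> 1" "0 \<le> \<theta>'"
  shows "dist (polyline Z m \<theta>) (polyline Z m' \<theta>') \<le> arc_length Z m' \<theta>' - arc_length Z m \<theta>"
proof (cases "m = m'")
  case True
  then show ?thesis using assms by (simp add: dist_polyline arc_length_def algebra_simps)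
next
  case False
  then show ?thesis
    using dist_via_vertex_le_arc_length[of m m' \<theta> \<theta>' Z] assms
      dist_triangle[of "polyline Z m \<theta>" "polyline Z m' \<theta>'" "Z ! Suc m"] by auto
qed

section \<open>Coordinates along and across the segment from s to t\<close>

locale frame =
  fixes T :: "real^2 \<Rightarrow> real^2" and s :: "real^2"
  assumes orth: "orthogonal_transformation T"
begin

text \<open>Coordinates are rotated instead of the configuration: this calls on the invariance of
  Lebesgue measure, not of the point process.\<close>

definition gx :: "real^2 \<Rightarrow> real" where "gx p = T (p - s) $ 1"
definition gy :: "real^2 \<Rightarrow> real" where "gy p = T (p - s) $ 2"

lemma linear_T: "linear T"
  using orth by (rule orthogonal_transformation_linear)

lemma inner_frame:
  "(p - q) \<bullet> (p' - q') = (gx p - gx q) * (gx p' - gx q') + (gy p - gy q) * (gy p' - gy q')"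
proof -
  have d: "T (p - s) - T (q - s) = T (p - q)" for p q
    by (simp add: linear_diff[OF linear_T, symmetric])
  have "(p - q) \<bullet> (p' - q') = T (p - q) \<bullet> T (p' - q')"
    using orth by (simp add: orthogonal_transformation_def)
  also have "\<dots> = (T (p - s) - T (q - s)) \<bullet> (T (p' - s) - T (q' - s))"
    by (simp only: d)
  finally show ?thesis by (simp add: inner_vec_def sum_2 gx_def gy_def)
qed

lemma dist_frame: "(dist p q)\<^sup>2 = (gx p - gx q)\<^sup>2 + (gy p - gy q)\<^sup>2"
  unfolding dist_norm power2_norm_eq_inner inner_frame by (simp add: power2_eq_square)

lemma gx_s [simp]: "gx s = 0" and gy_s [simp]: "gy s = 0"
  using linear_0[OF linear_T] by (simp_all add: gx_def gy_def)

lemma gx_affine: "gx (p + \<theta> *\<^sub>R (q - p)) = gx p + \<theta> * (gx q - gx p)"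
proof -
  have "p + \<theta> *\<^sub>R (q - p) - s = (p - s) + \<theta> *\<^sub>R ((q - s) - (p - s))" by simp
  then show ?thesis
    by (simp only: gx_def linear_add[OF linear_T] linear_scale[OF linear_T] linear_diff[OF linear_T]) simp
qed

lemma gx_polyline: "gx (polyline Z m \<theta>) = gx (Z ! m) + \<theta> * (gx (Z ! Suc m) - gx (Z ! m))"
  unfolding polyline_def by (rule gx_affine)

lemma gx_diff_le_dist: "\<bar>gx p - gx q\<bar> \<le> dist p q"
  by (rule power2_le_imp_le) (auto simp: dist_frame)

text \<open>Cauchy-Schwarz against the vector \<open>(1 - \<alpha>\<^sup>2, \<alpha>)\<close>, whose
  squared length \<open>1 - \<alpha>\<^sup>2 + \<alpha>^4\<close> is at most 1. The bound is linear
  in the height, so vertical movement costs excess length at a fixed rate.\<close>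

lemma dist_ge_linear:
  assumes "0 \<le> \<alpha>" "\<alpha> \<le> 1"
  shows "(1 - \<alpha>\<^sup>2) * (gx q - gx p) + \<alpha> * \<bar>gy q - gy p\<bar> \<le> dist p q"
proof (rule power2_le_imp_le)
  define a where "a = gx q - gx p"
  define b where "b = \<bar>gy q - gy p\<bar>"
  define c where "c = 1 - \<alpha>\<^sup>2"
  have "\<alpha>\<^sup>2 \<le> 1" using assms by (simp add: power_le_one)
  then have "\<alpha>\<^sup>2 * \<alpha>\<^sup>2 \<le> \<alpha>\<^sup>2 * 1" by (intro mult_left_mono) auto
  moreover have "c\<^sup>2 + \<alpha>\<^sup>2 = 1 - \<alpha>\<^sup>2 + \<alpha>\<^sup>2 * \<alpha>\<^sup>2" by (simp add: c_def power2_eq_square algebra_simps)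
  ultimately have "c\<^sup>2 + \<alpha>\<^sup>2 \<le> 1" by simp
  have "(c * a + \<alpha> * b)\<^sup>2 = (c\<^sup>2 + \<alpha>\<^sup>2) * (a\<^sup>2 + b\<^sup>2) - (c * b - \<alpha> * a)\<^sup>2"
    by algebra
  also have "\<dots> \<le> (c\<^sup>2 + \<alpha>\<^sup>2) * (a\<^sup>2 + b\<^sup>2)" by simp
  also have "\<dots> \<le> 1 * (a\<^sup>2 + b\<^sup>2)" using \<open>c\<^sup>2 + \<alpha>\<^sup>2 \<le> 1\<close> by (intro mult_right_mono) auto
  also have "\<dots> = a\<^sup>2 + b\<^sup>2" by simp
  also have "a\<^sup>2 + b\<^sup>2 = (dist p q)\<^sup>2"
    by (simp add: dist_frame a_def b_def power2_commute)
  finally show "((1 - \<alpha>\<^sup>2) * (gx q - gx p) + \<alpha> * \<bar>gy q - gy p\<bar>)\<^sup>2 \<le> (dist p q)\<^sup>2"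
    by (simp add: a_def b_def c_def)
qed simp

text \<open>The power of \<open>p\<close> with respect to the empty circle minus its power with respect to the
  circle with diameter \<open>[u, v]\<close> is affine in \<open>p\<close> and nonpositive on the chord \<open>[u, v]\<close>,
  hence nonpositive on one side of the chord.\<close>

lemma Del_edge_empty_side:
  assumes e: "closed_segment x y \<in> Del V"
    and u: "u \<in> closed_segment x y" and v: "v \<in> closed_segment x y" and uv: "gx u < gx v"
  shows "(\<forall>p\<in>V. gx u \<le> gx p \<longrightarrow> gx p \<le> gx v \<longrightarrow> gy u \<le> gy p \<longrightarrow> gy v \<le> gy p \<longrightarrow>
            0 \<le> (p - u) \<bullet> (p - v)) \<or>
         (\<forall>p\<in>V. gx u \<le> gx p \<longrightarrow> gx p \<le> gx v \<longrightarrow> gy p \<le> gy u \<longrightarrow> gy p \<le> gy v \<longrightarrow>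
            0 \<le> (p - u) \<bullet> (p - v))"
proof -
  obtain z where "delaunay_triple V x y z" using e by (auto simp: Del_edge_iff)
  then obtain c r where c: "{x, y, z} \<subseteq> sphere c r" "V \<inter> ball c r = {}"
    by (auto simp: delaunay_triple_def)
  then have r: "0 \<le> r" by auto
  have "closed_segment x y \<subseteq> cball c r"
    using c by (intro closed_segment_subset) auto
  then have uc: "dist u c \<le> r" and vc: "dist v c \<le> r"
    using u v by (auto simp: dist_commute)
  define \<alpha> where "\<alpha> = gx u + gx v - 2 * gx c"
  define \<beta> where "\<beta> = gy u + gy v - 2 * gy c"
  define \<gamma> where "\<gamma> = (gx c)\<^sup>2 + (gy c)\<^sup>2 - r\<^sup>2 - gx u * gx v - gy u * gy v"
  have D: "(dist p c)\<^sup>2 - r\<^sup>2 - (p - u) \<bullet> (p - v) = \<alpha> * gx p + \<beta> * gy p + \<gamma>" for p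
    unfolding dist_frame inner_frame \<alpha>_def \<beta>_def \<gamma>_def by algebra
  have Du: "\<alpha> * gx u + \<beta> * gy u + \<gamma> \<le> 0"
    using D[of u] power_mono[OF uc, of 2] by simp
  have Dv: "\<alpha> * gx v + \<beta> * gy v + \<gamma> \<le> 0"
    using D[of v] power_mono[OF vc, of 2] by simp
  have main: "0 \<le> (p - u) \<bullet> (p - v)"
    if p: "p \<in> V" "gx u \<le> gx p" "gx p \<le> gx v"
      and side: "\<beta> * gy p \<le> \<beta> * gy u" "\<beta> * gy p \<le> \<beta> * gy v" for p
  proof -
    \<comment> \<open>Comparison with the chord point of the same abscissa as \<open>p\<close>: the
      affine function is nonpositive there, and moving vertically to \<open>p\<close> does not
      increase it on the side given by the sign of \<open>\<beta>\<close>.\<close>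
    define \<mu> where "\<mu> = (gx p - gx u) / (gx v - gx u)"
    have "\<mu> * (gx v - gx u) = gx p - gx u" using uv by (simp add: \<mu>_def)
    then have \<mu>3: "gx p = (1 - \<mu>) * gx u + \<mu> * gx v" by (simp add: algebra_simps)
    have \<mu>: "0 \<le> \<mu>" "\<mu> \<le> 1" using p uv by (auto simp: \<mu>_def)
    have "(1 - \<mu>) * (\<alpha> * gx u + \<beta> * gy u + \<gamma>) \<le> 0" "\<mu> * (\<alpha> * gx v + \<beta> * gy v + \<gamma>) \<le> 0"
      using Du Dv \<mu> by (auto intro: mult_nonneg_nonpos)
    moreover have "(1 - \<mu>) * (\<beta> * gy p) \<le> (1 - \<mu>) * (\<beta> * gy u)" "\<mu> * (\<beta> * gy p) \<le> \<mu> * (\<beta> * gy v)"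
      using side \<mu> by (auto intro: mult_left_mono)
    moreover have "\<alpha> * gx p + \<beta> * gy p + \<gamma> = (1 - \<mu>) * (\<alpha> * gx u + \<beta> * gy u + \<gamma>) +
        \<mu> * (\<alpha> * gx v + \<beta> * gy v + \<gamma>) + ((1 - \<mu>) * (\<beta> * gy p) - (1 - \<mu>) * (\<beta> * gy u)) +
        (\<mu> * (\<beta> * gy p) - \<mu> * (\<beta> * gy v))"
      unfolding \<mu>3 by algebra
    ultimately have "(dist p c)\<^sup>2 - r\<^sup>2 - (p - u) \<bullet> (p - v) \<le> 0"
      unfolding D by linarith
    moreover have "r \<le> dist p c" using c(2) p(1) by (force simp: dist_commute)
    then have "r\<^sup>2 \<le> (dist p c)\<^sup>2" using r by (rule power_mono)
    ultimately show ?thesis by linarith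
  qed
  show ?thesis
  proof (cases "\<beta> \<le> 0")
    case True
    then show ?thesis by (intro disjI1) (auto intro!: main mult_left_mono_neg)
  next
    case False
    then show ?thesis by (intro disjI2) (auto intro!: main mult_left_mono)
  qed
qed

text \<open>For \<open>0 < i < K\<close>, \<open>q i\<close> is the last exit from the half-plane
  left of the line \<open>gx = i * w\<close>, and \<open>l i\<close> is the arc length there. Last
  exits occur in order along the path, and the edge through \<open>q i\<close> ends strictly beyond
  the line: either inside the strip, at a vertex, or not before the next line, so that it crosses
  the whole strip.\<close>

lemma path_strips:
  fixes K :: nat
  assumes Z: "del_path V s t Z" and sV: "s \<in> V" and gt: "gx t = real K * w" and w: "w > 0" and K: "K > 0"
  shows "\<exists>q l. q 0 = s \<and> q K = t \<and> l 0 = 0 \<and> l K = path_len Z \<and>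
     (\<forall>i\<le>K. gx (q i) = real i * w) \<and>
     (\<forall>i<K. dist (q i) (q (Suc i)) \<le> l (Suc i) - l i) \<and>
     (\<forall>i. 0 < i \<longrightarrow> i < K \<longrightarrow>
        (\<exists>p\<in>V. real i * w < gx p \<and> gx p < real (Suc i) * w \<and>
           dist (q i) p + dist p (q (Suc i)) \<le> l (Suc i) - l i) \<or>
        (\<exists>x y v. closed_segment x y \<in> Del V \<and> q i \<in> closed_segment x y \<and> v \<in> closed_segment x y \<and>
           gx v = real (Suc i) * w \<and> dist (q i) v \<le> l (Suc i) - l i))"
proof -
  define k where "k = length Z - 1"
  have len: "length Z = Suc k" and Z0: "Z ! 0 = s" and Zk: "Z ! k = t"
    using Z by (auto simp: del_path_def k_def hd_conv_nth last_conv_nth)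
  have edge: "closed_segment (Z ! j) (Z ! Suc j) \<in> Del V" if "j < k" for j
    using Z that by (auto simp: del_path_def len)
  have ZV: "Z ! j \<in> V" if "j \<le> k" for j
    using del_path_nth_mem[OF Z sV] that by (simp add: len)
  define S where "S i = {j. j \<le> k \<and> gx (Z ! j) \<le> real i * w}" for i
  \<comment> \<open>The ends are pinned to \<open>s\<close> and \<open>t\<close>, so that
    \<open>l\<close> runs from 0 to the full length. At \<open>i = K\<close> the out-of-range
    \<open>Z ! Suc k\<close> is only multiplied by the fraction 0.\<close>
  define m where "m i = (if i = 0 then 0 else if i = K then k else Max (S i))" for i
  define \<theta> where "\<theta> i = (if i = 0 \<or> i = K then 0 else
      (real i * w - gx (Z ! m i)) / (gx (Z ! Suc (m i)) - gx (Z ! m i)))" for i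
  define q where "q i = polyline Z (m i) (\<theta> i)" for i
  define l where "l i = arc_length Z (m i) (\<theta> i)" for i
  have finS: "finite (S i)" for i by (simp add: S_def)
  have "s \<noteq> t" using gt gx_s w K by (metis mult_pos_pos of_nat_0_less_iff less_irrefl)
  then have k0: "k > 0" using Z0 Zk by (cases k) auto
  have mid: "m i < k" "gx (Z ! m i) \<le> real i * w" "real i * w < gx (Z ! Suc (m i))"
    "\<And>j. j \<le> k \<Longrightarrow> gx (Z ! j) \<le> real i * w \<Longrightarrow> j \<le> m i" if i: "0 < i" "i < K" for i
  proof -
    have m: "m i = Max (S i)" using i by (simp add: m_def)
    have "0 \<in> S i" using Z0 w by (simp add: S_def)
    then have mS: "m i \<in> S i" unfolding m using finS by (intro Max_in) auto
    show le: "j \<le> m i" if "j \<le> k" "gx (Z ! j) \<le> real i * w" for j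
      unfolding m using that finS by (intro Max_ge) (auto simp: S_def)
    have "k \<notin> S i" using i w gt Zk by (auto simp: S_def)
    then show mk: "m i < k" using mS by (metis S_def le_neq_implies_less mem_Collect_eq)
    show "gx (Z ! m i) \<le> real i * w" using mS by (simp add: S_def)
    show "real i * w < gx (Z ! Suc (m i))" using le[of "Suc (m i)"] mk by force
  qed
  have mk: "m i < k" if "i < K" for i using mid(1)[of i] that k0 by (cases "i = 0") (auto simp: m_def)
  have mlek: "m i \<le> k" if "i \<le> K" for i using mk[of i] that by (cases "i = K") (auto simp: m_def)
  have \<theta>01: "0 \<le> \<theta> i" "\<theta> i \<le> 1" if "i \<le> K" for i
    using that mid(2,3)[of i] by (auto simp: \<theta>_def field_simps)
  have m_mono: "m i \<le> m (Suc i)" if "i < K" for i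
  proof (cases "i = 0 \<or> Suc i = K")
    case True
    then show ?thesis using mk[OF that] by (auto simp: m_def)
  next
    case False
    then show ?thesis
      using that mid[of i] mid(4)[of "Suc i" "m i"] w by (auto simp: algebra_simps)
  qed
  have \<theta>_mono: "\<theta> i \<le> \<theta> (Suc i)" if i: "i < K" "m i = m (Suc i)" for i
  proof (cases "i = 0")
    case True
    then show ?thesis using \<theta>01[of "Suc 0"] K by (simp add: \<theta>_def[of 0])
  next
    case False
    have "Suc i \<noteq> K" using mk[OF i(1)] i(2) by (auto simp: m_def)
    then show ?thesis using False i w mid(2,3)[of i]
      by (auto simp: \<theta>_def intro!: divide_right_mono)
  qed
  have order: "m i < m (Suc i) \<or> m i = m (Suc i) \<and> \<theta> i \<le> \<theta> (Suc i)" if "i < K" for i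
    using m_mono[OF that] \<theta>_mono[OF that] by linarith
  have gq: "gx (q i) = real i * w" if "i \<le> K" for i
  proof (cases "i = 0 \<or> i = K")
    case True
    then show ?thesis using Z0 Zk gt by (auto simp: q_def m_def \<theta>_def)
  next
    case False
    then show ?thesis
      using that mid(2,3)[of i] by (simp add: q_def gx_polyline \<theta>_def)
  qed
  have alt: "(\<exists>p\<in>V. real i * w < gx p \<and> gx p < real (Suc i) * w \<and>
           dist (q i) p + dist p (q (Suc i)) \<le> l (Suc i) - l i) \<or>
        (\<exists>x y v. closed_segment x y \<in> Del V \<and> q i \<in> closed_segment x y \<and> v \<in> closed_segment x y \<and>
           gx v = real (Suc i) * w \<and> dist (q i) v \<le> l (Suc i) - l i)" if i: "0 < i" "i < K" for i
  proof (cases "gx (Z ! Suc (m i)) < real (Suc i) * w")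
    case True
    have "m i < m (Suc i)"
    proof (cases "Suc i = K")
      case True
      then show ?thesis using mid(1)[OF i] by (simp add: m_def)
    next
      case False
      then show ?thesis using mid(4)[of "Suc i" "Suc (m i)"] mid(1)[OF i] i True by auto
    qed
    then have "dist (q i) (Z ! Suc (m i)) + dist (Z ! Suc (m i)) (q (Suc i)) \<le> l (Suc i) - l i"
      unfolding q_def l_def using \<theta>01 i by (intro dist_via_vertex_le_arc_length) auto
    then show ?thesis using mid[OF i] True ZV[of "Suc (m i)"] by (intro disjI1 bexI[of _ "Z ! Suc (m i)"]) auto
  next
    case False
    \<comment> \<open>The edge meets the right border at \<open>v\<close>. If both exits use the
      same edge, \<open>v = q (Suc i)\<close>; otherwise the end of this edge precedes
      \<open>q (Suc i)\<close> on the path, and \<open>v\<close> is no farther from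
      \<open>q i\<close> than that end.\<close>
    define \<phi> where "\<phi> = (real (Suc i) * w - gx (Z ! m i)) / (gx (Z ! Suc (m i)) - gx (Z ! m i))"
    define v where "v = polyline Z (m i) \<phi>"
    have den: "gx (Z ! Suc (m i)) - gx (Z ! m i) > 0" using mid(2,3)[OF i] by simp
    have \<theta>i: "\<theta> i = (real i * w - gx (Z ! m i)) / (gx (Z ! Suc (m i)) - gx (Z ! m i))"
      using i by (simp add: \<theta>_def)
    have \<phi>: "\<theta> i \<le> \<phi>" "\<phi> \<le> 1"
      using False den w unfolding \<phi>_def \<theta>i by (auto simp: divide_right_mono divide_le_eq_1)
    have gv: "gx v = real (Suc i) * w"
      using den by (simp add: v_def gx_polyline \<phi>_def)
    have qs: "q i \<in> closed_segment (Z ! m i) (Z ! Suc (m i))" "v \<in> closed_segment (Z ! m i) (Z ! Suc (m i))"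
      unfolding q_def v_def using \<phi> \<theta>01[of i] i by (auto intro!: polyline_in_segment)
    have "dist (q i) v \<le> l (Suc i) - l i"
    proof (cases "m i = m (Suc i)")
      case True
      then have "Suc i \<noteq> K" using mid(1)[OF i] by (auto simp: m_def)
      then have "\<phi> = \<theta> (Suc i)" using i True by (simp add: \<theta>_def \<phi>_def)
      then have "v = q (Suc i)" by (simp add: v_def q_def True)
      then show ?thesis
        unfolding q_def l_def using \<theta>01 i order
        by (metis Suc_leI dist_polyline_le_arc_length less_imp_le_nat)
    next
      case False
      then have "m i < m (Suc i)" using m_mono[OF i(2)] by simp
      then have "dist (q i) (Z ! Suc (m i)) + dist (Z ! Suc (m i)) (q (Suc i)) \<le> l (Suc i) - l i"
        unfolding q_def l_def using \<theta>01 i by (intro dist_via_vertex_le_arc_length) auto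
      moreover have "dist (q i) v \<le> dist (q i) (Z ! Suc (m i))"
        unfolding q_def v_def polyline_1[symmetric] dist_polyline
        using \<phi> by (intro mult_right_mono) auto
      ultimately show ?thesis using zero_le_dist[of "Z ! Suc (m i)" "q (Suc i)"] by linarith
    qed
    then show ?thesis using edge[OF mid(1)[OF i]] qs gv by blast
  qed
  have "\<forall>i<K. dist (q i) (q (Suc i)) \<le> l (Suc i) - l i"
    unfolding q_def l_def using \<theta>01 order
    by (metis Suc_leI dist_polyline_le_arc_length less_imp_le_nat)
  moreover have "q 0 = s" "q K = t" "l 0 = 0" "l K = path_len Z"
    using Z0 Zk K by (auto simp: q_def l_def m_def \<theta>_def arc_length_def path_len_def k_def)
  ultimately show ?thesis using gq alt by (intro exI[of _ q] exI[of _ l]) auto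
qed

section \<open>Test rectangles and the crossing of a single strip\<close>

definition rect :: "real \<Rightarrow> real \<Rightarrow> real \<Rightarrow> real \<Rightarrow> (real^2) set" where
  "rect a b c e = {p. a < gx p \<and> gx p < b \<and> c < gy p \<and> gy p < e}"

text \<open>Strip \<open>i\<close> is \<open>i w < gx < (i + 1) w\<close>; row \<open>r\<close> is \<open>r w / 10\<^sup>4 \<le> gy < (r + 1) w / 10\<^sup>4\<close>.\<close>

definition thin :: "real \<Rightarrow> nat \<Rightarrow> int \<Rightarrow> (real^2) set" where
  "thin w i r = rect (real i * w) (real (Suc i) * w) ((r - 3/2) * (w / 10000)) ((r + 5/2) * (w / 10000))"

text \<open>The disk whose diameter is a horizontal crossing extends at least
  \<open>2/5 * w\<close>, or 4000 rows, above it over the middle three fifths of the strip. Stopping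
  at 3810 leaves room for the tilt of the crossing and its position in the row; starting at 10
  clears the crossing and \<open>thin\<close>.\<close>

definition upper :: "real \<Rightarrow> nat \<Rightarrow> int \<Rightarrow> (real^2) set" where
  "upper w i r = rect ((real i + 1/5) * w) ((real i + 4/5) * w) ((r + 10) * (w / 10000)) ((r + 3810) * (w / 10000))"

definition lower :: "real \<Rightarrow> nat \<Rightarrow> int \<Rightarrow> (real^2) set" where
  "lower w i r = rect ((real i + 1/5) * w) ((real i + 4/5) * w) ((r - 3810) * (w / 10000)) ((r - 10) * (w / 10000))"

text \<open>Good for the path: what a cheap crossing demands of the process. For a fixed row it is
  unlikely at the width chosen later.\<close>

definition good :: "(real^2) set \<Rightarrow> real \<Rightarrow> nat \<Rightarrow> int \<Rightarrow> bool" where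
  "good V w i r \<longleftrightarrow> V \<inter> thin w i r \<noteq> {} \<or> V \<inter> upper w i r = {} \<or> V \<inter> lower w i r = {}"

text \<open>By Pythagoras the height is of the order of the square root of the excess: its square is
  at most about \<open>2 * w * (w / 10^8)\<close>, and the square root of 2 is below 3/2. The case
  \<open>p = q'\<close> serves for an edge that crosses the strip.\<close>

lemma detour_height:
  assumes w: "w > 0" and q: "gx q \<le> gx p" "gx p \<le> gx q'" "gx q' = gx q + w"
    and d: "dist q p + dist p q' < w + w / 10^8"
  shows "\<bar>gy p - gy q\<bar> < 3/2 * (w / 10000)"
proof -
  define a where "a = gx p - gx q"
  have a: "0 \<le> a" "a \<le> w" using q by (auto simp: a_def)
  have "dist p q' \<ge> w - a" using gx_diff_le_dist[of p q'] q by (simp add: a_def)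
  then have "dist q p < a + w / 10^8" using d by linarith
  then have "(dist q p)\<^sup>2 < (a + w / 10^8)\<^sup>2" by (rule power_strict_mono) auto
  then have "(gy p - gy q)\<^sup>2 < (a + w / 10^8)\<^sup>2 - a\<^sup>2"
    by (simp add: dist_frame a_def power2_commute)
  also have "(a + w / 10^8)\<^sup>2 - a\<^sup>2 = 2 * a * (w / 10^8) + (w / 10^8)\<^sup>2"
    by (simp add: power2_eq_square algebra_simps)
  also have "\<dots> \<le> 2 * w * (w / 10^8) + (w / 10^8)\<^sup>2"
    using a w by (intro add_right_mono mult_right_mono) auto
  also have "\<dots> \<le> (3/2 * (w / 10000))\<^sup>2"
    by (simp add: power2_eq_square field_simps)
  finally have "\<bar>gy p - gy q\<bar>\<^sup>2 < (3/2 * (w / 10000))\<^sup>2" by simp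
  then show ?thesis by (rule power2_less_imp_less) (use w in auto)
qed

text \<open>Both rectangles lie inside the disk with diameter \<open>[u, v]\<close>: the horizontal
  part of the inner product is below \<open>- (4/25) * w * w\<close> over the middle three fifths,
  and the vertical part is at most the square of 3820 rows, that is of \<open>0.382 * w\<close>.
  \<open>Del_edge_empty_side\<close> empties the disk on one side of the chord, hence one
  rectangle.\<close>

lemma crossing_empty:
  assumes w: "w > 0" and e: "closed_segment x y \<in> Del V"
    and u: "u \<in> closed_segment x y" "gx u = real i * w" and v: "v \<in> closed_segment x y" "gx v = real (Suc i) * w"
    and row: "r * (w / 10000) \<le> gy u" "gy u < (r + 1) * (w / 10000)"
    and h: "\<bar>gy v - gy u\<bar> < 3/2 * (w / 10000)"
  shows "V \<inter> upper w i r = {} \<or> V \<inter> lower w i r = {}"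
proof -
  have uv: "gx u < gx v" using u v w by (simp add: algebra_simps)
  define \<eta> where "\<eta> = w / 10000"
  have w\<eta>: "w = 10000 * \<eta>" by (simp add: \<eta>_def)
  have \<eta>: "\<eta> > 0" using w by (simp add: \<eta>_def)
  have row': "r * \<eta> \<le> gy u" "gy u < (r + 1) * \<eta>" "gy v - gy u < 3/2 * \<eta>" "gy u - gy v < 3/2 * \<eta>"
    using row h unfolding \<eta>_def[symmetric] abs_less_iff by auto
  have neg: "(p - u) \<bullet> (p - v) < 0"
    if x: "(i + 1/5) * w < gx p" "gx p < (i + 4/5) * w"
      and y: "\<bar>gy p - gy u\<bar> \<le> 3820 * \<eta>" "\<bar>gy p - gy v\<bar> \<le> 3820 * \<eta>" for p
  proof -
    define a where "a = gx p - gx u"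
    have a: "a > w / 5" "a < 4/5 * w" using x u by (auto simp: a_def algebra_simps)
    have "(a - w/5) * (4/5 * w - a) > 0" using a by simp
    moreover have "(a - w/5) * (4/5 * w - a) = - (a * (a - w)) - (4/25) * w * w"
      by (simp add: field_simps)
    ultimately have "a * (a - w) < - (4/25) * w * w" by simp
    moreover have "(gx p - gx u) * (gx p - gx v) = a * (a - w)"
      using u v by (simp add: a_def algebra_simps)
    moreover have "(gy p - gy u) * (gy p - gy v) \<le> (3820 * \<eta>) * (3820 * \<eta>)"
    proof -
      have "(gy p - gy u) * (gy p - gy v) \<le> \<bar>gy p - gy u\<bar> * \<bar>gy p - gy v\<bar>"
        by (simp flip: abs_mult)
      also have "\<dots> \<le> (3820 * \<eta>) * (3820 * \<eta>)" using y \<eta> by (intro mult_mono) auto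
      finally show ?thesis .
    qed
    moreover have "(3820 * \<eta>) * (3820 * \<eta>) < (4/25) * w * w" using \<eta> by (simp add: w\<eta>)
    ultimately show ?thesis unfolding inner_frame by linarith
  qed
  have x: "gx u \<le> gx p \<and> gx p \<le> gx v" if "(i + 1/5) * w < gx p" "gx p < (i + 4/5) * w" for p
    using that u v w by (simp add: algebra_simps)
  have up: "(p - u) \<bullet> (p - v) < 0 \<and> gx u \<le> gx p \<and> gx p \<le> gx v \<and> gy u \<le> gy p \<and> gy v \<le> gy p"
    if "p \<in> upper w i r" for p
  proof -
    have p: "(i + 1/5) * w < gx p" "gx p < (i + 4/5) * w" "(r + 10) * \<eta> < gy p" "gy p < (r + 3810) * \<eta>"
      using that by (auto simp: upper_def rect_def \<eta>_def)
    have "gy u + 8 * \<eta> < gy p" "gy v + 7 * \<eta> < gy p" "gy p < gy u + 3810 * \<eta>" "gy p < gy v + 3812 * \<eta>"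
      using p(3,4) row' \<eta> by (auto simp: algebra_simps)
    then show ?thesis using neg[OF p(1,2)] x[OF p(1,2)] \<eta> by auto
  qed
  have low: "(p - u) \<bullet> (p - v) < 0 \<and> gx u \<le> gx p \<and> gx p \<le> gx v \<and> gy p \<le> gy u \<and> gy p \<le> gy v"
    if "p \<in> lower w i r" for p
  proof -
    have p: "(i + 1/5) * w < gx p" "gx p < (i + 4/5) * w" "(r - 3810) * \<eta> < gy p" "gy p < (r - 10) * \<eta>"
      using that by (auto simp: lower_def rect_def \<eta>_def)
    have "gy p + 8 * \<eta> < gy u" "gy p + 7 * \<eta> < gy v" "gy u < gy p + 3812 * \<eta>" "gy v < gy p + 3814 * \<eta>"
      using p(3,4) row' \<eta> by (auto simp: algebra_simps)
    then show ?thesis using neg[OF p(1,2)] x[OF p(1,2)] \<eta> by auto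
  qed
  from Del_edge_empty_side[OF e u(1) v(1) uv] show ?thesis
  proof
    assume "\<forall>p\<in>V. gx u \<le> gx p \<longrightarrow> gx p \<le> gx v \<longrightarrow> gy u \<le> gy p \<longrightarrow> gy v \<le> gy p \<longrightarrow>
            0 \<le> (p - u) \<bullet> (p - v)"
    then have "V \<inter> upper w i r = {}" using up by fastforce
    then show ?thesis ..
  next
    assume "\<forall>p\<in>V. gx u \<le> gx p \<longrightarrow> gx p \<le> gx v \<longrightarrow> gy p \<le> gy u \<longrightarrow> gy p \<le> gy v \<longrightarrow>
            0 \<le> (p - u) \<bullet> (p - v)"
    then have "V \<inter> lower w i r = {}" using low by fastforce
    then show ?thesis ..
  qed
qed

text \<open>\<open>r i\<close> is the row in which the path leaves the line \<open>gx = i w\<close> for the last time, and \<open>c i\<close> is the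
  excess length spent on strip \<open>i\<close>, in units of \<open>w / (5 * 10\<^sup>8)\<close>.\<close>

lemma cheap_path_rows:
  fixes K :: nat and w :: real
  assumes Z: "del_path (X \<union> {s, t}) s t Z" and gt: "gx t = real K * w" "gy t = 0" and w: "w > 0" and K: "K > 0"
    and len: "path_len Z \<le> (1 + 2.47 / 10 ^ 11) * (K * w)"
  obtains r :: "nat \<Rightarrow> int" and c :: "nat \<Rightarrow> real" where
    "r 0 = 0" "\<And>i. i < K \<Longrightarrow> 0 \<le> c i" "\<And>i. i < K \<Longrightarrow> \<bar>r (Suc i) - r i\<bar> \<le> c i + 6/5"
    "(\<Sum>i<K. c i) \<le> 1235/100000 * K"
    "\<And>i. 0 < i \<Longrightarrow> i < K \<Longrightarrow> c i < 5 \<Longrightarrow> good X w i (r i)"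
proof -
  obtain q l where ql: "q 0 = s" "q K = t" "l 0 = 0" "l K = path_len Z"
     "\<And>i. i \<le> K \<Longrightarrow> gx (q i) = real i * w"
     "\<And>i. i < K \<Longrightarrow> dist (q i) (q (Suc i)) \<le> l (Suc i) - l i"
     and alt: "\<And>i. 0 < i \<Longrightarrow> i < K \<Longrightarrow>
        (\<exists>p\<in>X \<union> {s, t}. real i * w < gx p \<and> gx p < real (Suc i) * w \<and>
           dist (q i) p + dist p (q (Suc i)) \<le> l (Suc i) - l i) \<or>
        (\<exists>x y v. closed_segment x y \<in> Del (X \<union> {s, t}) \<and> q i \<in> closed_segment x y \<and> v \<in> closed_segment x y \<and>
           gx v = real (Suc i) * w \<and> dist (q i) v \<le> l (Suc i) - l i)"
    using path_strips[OF Z _ gt(1) w K] by auto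
  define \<eta> where "\<eta> = w / 10000"
  have w\<eta>: "w = 10000 * \<eta>" by (simp add: \<eta>_def)
  have \<eta>: "\<eta> > 0" using w by (simp add: \<eta>_def)
  define r where "r i = \<lfloor>gy (q i) / \<eta>\<rfloor>" for i
  define c where "c i = (5 * 10^8 / w) * (l (Suc i) - l i - w)" for i
  have row: "r i * \<eta> \<le> gy (q i)" "gy (q i) < (r i + 1) * \<eta>" for i
    using \<eta> floor_correct[of "gy (q i) / \<eta>"]
    unfolding r_def pos_le_divide_eq[OF \<eta>] pos_divide_less_eq[OF \<eta>] by simp_all
  have dx: "gx (q (Suc i)) - gx (q i) = w" if "i < K" for i
    using ql(5) that by (simp add: algebra_simps)
  show ?thesis
  proof
    show "r 0 = 0" using ql(1) by (simp add: r_def)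
    fix i assume i: "i < K"
    show "0 \<le> c i"
      using gx_diff_le_dist[of "q i" "q (Suc i)"] dx[OF i] ql(6)[OF i] w by (simp add: c_def)
    \<comment> \<open>With the slope 1/50000 one row of height costs one unit of \<open>c\<close>,
      as \<open>5 * 10^8 / 50000 = 10^4\<close>. The quadratic term loses
      \<open>5 * 10^8 / 50000^2 = 1/5\<close>.\<close>
    have "(1 - (1/50000)\<^sup>2) * (gx (q (Suc i)) - gx (q i)) + (1/50000) * \<bar>gy (q (Suc i)) - gy (q i)\<bar> \<le>
       dist (q i) (q (Suc i))"
      by (rule dist_ge_linear) auto
    then have "(1/50000) * \<bar>gy (q (Suc i)) - gy (q i)\<bar> - (1/50000)\<^sup>2 * w \<le> l (Suc i) - l i - w"
      unfolding dx[OF i] using ql(6)[OF i] by (simp add: algebra_simps)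
    then have "(5 * 10^8 / w) * ((1/50000) * \<bar>gy (q (Suc i)) - gy (q i)\<bar> - (1/50000)\<^sup>2 * w) \<le> c i"
      unfolding c_def using w by (intro mult_left_mono) auto
    also have "(5 * 10^8 / w) * ((1/50000) * \<bar>gy (q (Suc i)) - gy (q i)\<bar> - (1/50000)\<^sup>2 * w) =
        \<bar>gy (q (Suc i)) - gy (q i)\<bar> / \<eta> - 1/5"
      using \<eta> by (simp add: w\<eta> field_simps power2_eq_square)
    also have "\<bar>gy (q (Suc i)) - gy (q i)\<bar> / \<eta> = \<bar>gy (q (Suc i)) / \<eta> - gy (q i) / \<eta>\<bar>"
      using \<eta> by (simp add: abs_divide flip: diff_divide_distrib)
    finally have "\<bar>gy (q (Suc i)) / \<eta> - gy (q i) / \<eta>\<bar> - 1/5 \<le> c i" .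
    \<comment> \<open>Rounding both heights down to rows adds at most 1 to the loss of 1/5.\<close>
    then show "\<bar>r (Suc i) - r i\<bar> \<le> c i + 6/5"
      unfolding r_def by linarith
  next
    have "(\<Sum>i<K. c i) = (5 * 10^8 / w) * (\<Sum>i<K. l (Suc i) - l i - w)"
      by (simp add: c_def sum_distrib_left)
    also have "(\<Sum>i<K. l (Suc i) - l i - w) = (\<Sum>i<K. l (Suc i) - l i) - K * w"
      by (simp add: sum_subtractf)
    also have "(\<Sum>i<K. l (Suc i) - l i) = path_len Z"
      using ql by (simp add: sum_lessThan_telescope)
    also have "(5 * 10^8 / w) * (path_len Z - K * w) \<le> (5 * 10^8 / w) * ((2.47 / 10^11) * (K * w))"
      using len w by (intro mult_left_mono) (auto simp: algebra_simps)
    also have "\<dots> = 1235/100000 * K" using w by simp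
    finally show "(\<Sum>i<K. c i) \<le> 1235/100000 * K" .
  next
    fix i assume i: "0 < i" "i < K" and c: "c i < 5"
    have cheap: "l (Suc i) - l i < w + w / 10^8"
    proof -
      have "c i * (w / (5 * 10^8)) < 5 * (w / (5 * 10^8))"
        using c w by (intro mult_strict_right_mono) auto
      moreover have "c i * (w / (5 * 10^8)) = l (Suc i) - l i - w"
        using w by (simp add: c_def)
      ultimately have "l (Suc i) - l i - w < 5 * (w / (5 * 10^8))" by (simp only:)
      then show ?thesis by (simp add: field_simps)
    qed
    have gq: "gx (q i) = real i * w" "gx (q (Suc i)) = real (Suc i) * w" using ql(5) i by auto
    have gq': "gx (q (Suc i)) = gx (q i) + w" using dx[OF i(2)] by simp
    from alt[OF i] show "good X w i (r i)"
    proof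
      assume "\<exists>p\<in>X \<union> {s, t}. real i * w < gx p \<and> gx p < real (Suc i) * w \<and>
           dist (q i) p + dist p (q (Suc i)) \<le> l (Suc i) - l i"
      then obtain p where p: "p \<in> X \<union> {s, t}" "real i * w < gx p" "gx p < real (Suc i) * w"
           "dist (q i) p + dist p (q (Suc i)) \<le> l (Suc i) - l i" by blast
      \<comment> \<open>The added points have abscissas 0 and \<open>K * w\<close>, outside every
        open strip, so \<open>p\<close> belongs to the process itself.\<close>
      have "0 \<le> real i * w" "real (Suc i) * w \<le> real K * w" using w i by auto
      then have "p \<noteq> s" "p \<noteq> t" using p(2,3) gt by auto
      then have "p \<in> X" using p(1) by simp
      moreover have "\<bar>gy p - gy (q i)\<bar> < 3/2 * (w / 10000)"
        using p gq cheap w by (intro detour_height[OF w _ _ gq']) auto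
      then have "gy p - gy (q i) < 3/2 * \<eta>" "gy (q i) - gy p < 3/2 * \<eta>"
        unfolding \<eta>_def[symmetric] abs_less_iff by auto
      then have "p \<in> thin w i (r i)"
        using p(2,3) row[of i] unfolding thin_def rect_def \<eta>_def[symmetric]
        by (auto simp: algebra_simps)
      ultimately show ?thesis by (auto simp: good_def)
    next
      assume "\<exists>x y v. closed_segment x y \<in> Del (X \<union> {s, t}) \<and> q i \<in> closed_segment x y \<and> v \<in> closed_segment x y \<and>
           gx v = real (Suc i) * w \<and> dist (q i) v \<le> l (Suc i) - l i"
      then obtain x y v where v: "closed_segment x y \<in> Del (X \<union> {s, t})" "q i \<in> closed_segment x y"
        "v \<in> closed_segment x y" "gx v = real (Suc i) * w" "dist (q i) v \<le> l (Suc i) - l i" by blast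
      have "gx v = gx (q i) + w" using v(4) gq(1) by (simp add: algebra_simps)
      then have "\<bar>gy v - gy (q i)\<bar> < 3/2 * (w / 10000)"
        using v(5) cheap w by (intro detour_height[of w "q i" v v]) auto
      then have "(X \<union> {s, t}) \<inter> upper w i (r i) = {} \<or> (X \<union> {s, t}) \<inter> lower w i (r i) = {}"
        using row[of i] gq(1) v by (intro crossing_empty[OF w v(1,2) _ v(3,4)]) (auto simp: \<eta>_def)
      then show ?thesis by (auto simp: good_def)
    qed
  qed
qed

end

subsection \<open>First moment bound\<close>

lemma exp_neg_5_le: "exp (- 5 :: real) \<le> 1024 / 100000"
proof -
  have "(5/2 :: real) \<le> exp 1" using exp_lower_Taylor_quadratic[of 1] by simp
  then have "(5/2 :: real)^5 \<le> exp 1 ^ 5" by (rule power_mono) simp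
  then have "(5/2 :: real)^5 \<le> exp 5" by (simp flip: exp_of_nat_mult)
  then have "inverse (exp 5) \<le> inverse ((5/2 :: real)^5)" by (rule le_imp_inverse_le) simp
  then show ?thesis by (simp add: exp_minus power_divide)
qed

text \<open>The total weight of all row changes in one strip. As \<open>exp (- 1) \<le> 2/5\<close>,
  the geometric sum is at most 2/3, so the whole is at most \<open>4 * (7/3)\<close>. The exponent
  5/4 exceeds the slack 6/5 of a row change by 1/20.\<close>

lemma sum_exp_abs_le: "(\<Sum>j\<in>{- int J..int J}. exp (5/4 - \<bar>real_of_int j\<bar>)) \<le> 10"
proof -
  define x where "x = exp (- 1 :: real)"
  have "(5/2 :: real) \<le> exp 1" using exp_lower_Taylor_quadratic[of 1] by simp
  then have "inverse (exp 1) \<le> inverse (5/2 :: real)" by (rule le_imp_inverse_le) simp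
  then have x: "0 < x" "x \<le> 2/5" by (auto simp: x_def exp_minus)
  have pow: "exp (5/4 - real k) = exp (5/4) * x ^ k" for k
  proof -
    have "x ^ k = exp (- real k)" by (simp add: x_def flip: exp_of_nat_mult)
    then show ?thesis by (simp flip: exp_add)
  qed
  have "(\<Sum>j\<in>{- int J..int J}. exp (5/4 - \<bar>real_of_int j\<bar>)) = exp (5/4) * (1 + 2 * (\<Sum>k=1..J. x ^ k))"
  proof (induction J)
    case (Suc J)
    have "{- int (Suc J)..int (Suc J)} = insert (- int (Suc J)) (insert (int (Suc J)) {- int J..int J})"
      by auto
    then have "(\<Sum>j\<in>{- int (Suc J)..int (Suc J)}. exp (5/4 - \<bar>real_of_int j\<bar>)) =
      exp (5/4 - real (Suc J)) + (exp (5/4 - real (Suc J)) + (\<Sum>j\<in>{- int J..int J}. exp (5/4 - \<bar>real_of_int j\<bar>)))"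
      by (simp add: abs_if)
    then show ?case unfolding Suc.IH pow by (simp add: algebra_simps)
  qed simp
  also have "(\<Sum>k=1..J. x ^ k) \<le> 2/3"
  proof -
    have "(1 - x) * (\<Sum>k=1..J. x ^ k) = x - x ^ Suc J"
    proof (induction J)
      case (Suc J)
      have "(1 - x) * (\<Sum>k=1..Suc J. x ^ k) = (1 - x) * (\<Sum>k=1..J. x ^ k) + (1 - x) * x ^ Suc J"
        by (simp add: distrib_left)
      also have "\<dots> = x - x ^ Suc (Suc J)" unfolding Suc.IH by (simp add: algebra_simps)
      finally show ?case .
    qed simp
    then have "(1 - x) * (\<Sum>k=1..J. x ^ k) \<le> x" using x by simp
    moreover have "(3/5) * (\<Sum>k=1..J. x ^ k) \<le> (1 - x) * (\<Sum>k=1..J. x ^ k)"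
      using x by (intro mult_right_mono sum_nonneg) auto
    ultimately show ?thesis using x by linarith
  qed
  also have "exp (5/4 :: real) \<le> 4"
  proof -
    have "exp (1/4 :: real) \<le> 4/3"
      using exp_ge_add_one_self[of "- 1/4 :: real"] by (simp add: exp_minus field_simps)
    then have "exp 1 * exp (1/4 :: real) \<le> 3 * (4/3)"
      using exp_le by (intro mult_mono) auto
    then show ?thesis by (simp flip: exp_add)
  qed
  finally show ?thesis by simp
qed

context frame
begin

section \<open>Rectangles in the rotated coordinates and their areas\<close>

lemma continuous_frame [continuous_intros]: "continuous_on S gx" "continuous_on S gy"
proof -
  have "continuous_on S (\<lambda>p. T (p - s) $ i)" for i
    by (intro continuous_intros linear_continuous_on_compose[OF _ linear_T])
  then show "continuous_on S gx" "continuous_on S gy" by (auto simp: gx_def gy_def)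
qed

lemma open_rect: "open (rect a b c e)"
  unfolding rect_def by (intro open_Collect_conj open_Collect_less continuous_intros)

lemma bounded_rect: "bounded (rect a b c e)"
proof (rule bounded_subset[OF bounded_cball[of s "\<bar>a\<bar> + \<bar>b\<bar> + \<bar>c\<bar> + \<bar>e\<bar>"]], rule subsetI)
  fix p assume p: "p \<in> rect a b c e"
  have "(dist s p)\<^sup>2 \<le> (\<bar>gx p\<bar> + \<bar>gy p\<bar>)\<^sup>2"
    unfolding dist_frame by (simp add: power2_sum)
  then have "dist s p \<le> \<bar>gx p\<bar> + \<bar>gy p\<bar>" by (rule power2_le_imp_le) simp
  then show "p \<in> cball s (\<bar>a\<bar> + \<bar>b\<bar> + \<bar>c\<bar> + \<bar>e\<bar>)" using p by (auto simp: rect_def)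
qed

lemma sets_rect [simp]: "rect a b c e \<in> sets borel"
  by (rule borel_open[OF open_rect])

lemma measure_rect:
  assumes "a \<le> b" "c \<le> e"
  shows "measure lborel (rect a b c e) = (b - a) * (e - c)"
proof -
  let ?l = "vector [a, c] :: real^2" and ?u = "vector [b, e] :: real^2"
  have img: "T ` ((\<lambda>p. p - s) ` rect a b c e) = box ?l ?u"
  proof (intro equalityI subsetI)
    fix z assume "z \<in> T ` ((\<lambda>p. p - s) ` rect a b c e)"
    then show "z \<in> box ?l ?u"
      by (auto simp: mem_box_cart forall_2 rect_def gx_def gy_def)
  next
    fix z assume z: "z \<in> box ?l ?u"
    obtain y where y: "z = T y" using orthogonal_transformation_surj[OF orth] by (metis surjD)
    have "y + s \<in> rect a b c e" using z by (simp add: y mem_box_cart forall_2 rect_def gx_def gy_def)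
    then show "z \<in> T ` ((\<lambda>p. p - s) ` rect a b c e)"
      unfolding y by (force simp: image_iff)
  qed
  have "(\<lambda>p. p - s) ` rect a b c e \<in> lmeasurable"
    using open_rect bounded_rect
    by (intro lmeasurable_open bounded_translation_minus open_translation_subtract)
  then have "measure lebesgue (box ?l ?u) = measure lebesgue ((\<lambda>p. p - s) ` rect a b c e)"
    unfolding img[symmetric] by (rule measure_orthogonal_image[OF orth])
  also have "\<dots> = measure lborel (rect a b c e)"
    by (simp add: measure_translation_subtract measure_completion)
  finally have "measure lborel (rect a b c e) = measure lborel (cbox ?l ?u)"
    by (simp add: measure_completion measure_lborel_box_eq measure_lborel_cbox_eq)
  also have "\<dots> = (b - a) * (e - c)"
    using assms by (subst content_cbox_cart) (auto simp: interval_ne_empty_cart forall_2 UNIV_2)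
  finally show ?thesis .
qed

text \<open>Strip 0 is exempt: after leaving \<open>s\<close> the path may return to \<open>gx \<le> 0\<close>, so its last exit from
  the line through \<open>s\<close> need not be at \<open>s\<close>. The summand \<open>exp (- 5)\<close> accounts for expensive strips.\<close>

definition strip_weight :: "(real^2) set \<Rightarrow> real \<Rightarrow> (nat \<Rightarrow> int) \<Rightarrow> nat \<Rightarrow> real" where
  "strip_weight V w r i = of_bool (i = 0 \<or> card (V \<inter> thin w i (r i)) \<noteq> 0 \<or>
     card (V \<inter> upper w i (r i)) = 0 \<or> card (V \<inter> lower w i (r i)) = 0) + exp (- 5)"

lemma exp_neg_5_le_strip_weight: "exp (- 5) \<le> strip_weight V w r i"
  unfolding strip_weight_def le_add_same_cancel2 by (rule zero_less_eq_of_bool)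

lemma strip_weight_nonneg: "0 \<le> strip_weight V w r i"
  using exp_ge_zero exp_neg_5_le_strip_weight by (rule order_trans)

lemma strip_weight_le: "strip_weight V w r i \<le> 1 + exp (- 5)"
  unfolding strip_weight_def add_le_cancel_right by (rule of_bool_less_eq_one)

text \<open>The rectangles of strip \<open>i\<close> get the indices \<open>3 * i\<close>,
  \<open>3 * i + 1\<close> and \<open>3 * i + 2\<close> in one disjoint family. Their counts are
  independent, and so are functions of disjoint blocks of counts.\<close>

lemma indep_strip_weight:
  assumes P: "poisson_point_process M X n" and w: "w > 0"
  shows "prob_space.indep_vars M (\<lambda>_. borel) (\<lambda>i \<omega>. strip_weight (X \<omega>) w r i) {..<K}"
proof -
  interpret prob_space M using P by (simp add: poisson_point_process_def)
  define B where "B k = (if k mod 3 = 0 then thin w (k div 3) (r (k div 3)) else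
      if k mod 3 = 1 then upper w (k div 3) (r (k div 3)) else lower w (k div 3) (r (k div 3)))" for k
  have B: "B k \<in> sets borel" "bounded (B k)" for k
    by (auto simp: B_def thin_def upper_def lower_def bounded_rect)
  have strip: "real (k div 3) * w < gx p" "gx p < real (Suc (k div 3)) * w" if "p \<in> B k" for k p
  proof -
    have "0 < w / 5" using w by simp
    then show "real (k div 3) * w < gx p" "gx p < real (Suc (k div 3)) * w"
      using that by (auto simp: B_def thin_def upper_def lower_def rect_def algebra_simps split: if_splits)
  qed
  \<comment> \<open>A common point forces equal strips, since these are open and disjoint; within a
    strip the rectangles are separated by \<open>gy\<close>.\<close>
  have disj: "B k \<inter> B k' = {}" if "k \<noteq> k'" for k k'
  proof (rule ccontr)
    assume "B k \<inter> B k' \<noteq> {}"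
    then obtain p where p: "p \<in> B k" "p \<in> B k'" by blast
    have "real (k div 3) * w < real (Suc (k' div 3)) * w" "real (k' div 3) * w < real (Suc (k div 3)) * w"
      using strip[OF p(1)] strip[OF p(2)] by linarith+
    then have "real (k div 3) < real (Suc (k' div 3))" "real (k' div 3) < real (Suc (k div 3))"
      using w by (simp_all add: mult_less_cancel_right_pos)
    then have dk: "k div 3 = k' div 3" by linarith
    then have "k mod 3 \<noteq> k' mod 3" using that by (metis div_mult_mod_eq)
    moreover have "k mod 3 = 0 \<or> k mod 3 = 1 \<or> k mod 3 = 2" "k' mod 3 = 0 \<or> k' mod 3 = 1 \<or> k' mod 3 = 2"
      by presburger+
    ultimately show False
      using p w dk by (auto simp: B_def thin_def upper_def lower_def rect_def algebra_simps split: if_splits)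
  qed
  have ind: "indep_vars (\<lambda>_. count_space UNIV) (\<lambda>k \<omega>. card (X \<omega> \<inter> B k)) {..<3 * K}"
    using P B disj unfolding poisson_point_process_def
    by (simp add: disjoint_family_on_def)
  define J where "J i = {3 * i, 3 * i + 1, 3 * i + 2}" for i :: nat
  have "indep_vars (\<lambda>i. PiM (J i) (\<lambda>_. count_space UNIV))
     (\<lambda>i \<omega>. restrict (\<lambda>k. card (X \<omega> \<inter> B k)) (J i)) {..<K}"
    by (rule indep_vars_restrict[OF ind]) (auto simp: J_def disjoint_family_on_def)
  note ind' = this
  define Y where "Y i f = of_bool (i = 0 \<or> f (3 * i) \<noteq> 0 \<or> f (3 * i + 1) = 0 \<or> f (3 * i + 2) = 0) + exp (- 5 :: real)"
    for i and f :: "nat \<Rightarrow> nat"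
  have "Y i \<in> borel_measurable (PiM (J i) (\<lambda>_. count_space UNIV))" for i
  proof -
    have [measurable]: "(\<lambda>f. f k) \<in> measurable (PiM (J i) (\<lambda>_. count_space (UNIV :: nat set))) (count_space UNIV)" if "k \<in> J i" for k
      using that by (rule measurable_component_singleton)
    have [measurable]: "3 * i \<in> J i" "3 * i + 1 \<in> J i" "3 * i + 2 \<in> J i" by (auto simp: J_def)
    show ?thesis unfolding Y_def by measurable
  qed
  then have "indep_vars (\<lambda>_. borel) (\<lambda>i \<omega>. Y i (restrict (\<lambda>k. card (X \<omega> \<inter> B k)) (J i))) {..<K}"
    by (intro indep_vars_compose2[OF ind'])
  also have "(\<lambda>i \<omega>. Y i (restrict (\<lambda>k. card (X \<omega> \<inter> B k)) (J i))) = (\<lambda>i \<omega>. strip_weight (X \<omega>) w r i)"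
  proof (intro ext)
    fix i :: nat and \<omega>
    have "(3 * i + 1) div 3 = i" "(3 * i + 2) div 3 = i" "(3 * i + 1) mod 3 = 1" "(3 * i + 2) mod 3 = 2"
      by presburger+
    then show "Y i (restrict (\<lambda>k. card (X \<omega> \<inter> B k)) (J i)) = strip_weight (X \<omega>) w r i"
      unfolding Y_def strip_weight_def by (simp add: J_def B_def split del: split_of_bool)
  qed
  finally show ?thesis .
qed

text \<open>Union bound, with areas \<open>4/10000 * w\<^sup>2\<close> for \<open>thin\<close> and
  \<open>228/1000 * w\<^sup>2\<close> for each of the others. The upper bound on
  \<open>n * w\<^sup>2\<close> makes points in \<open>thin\<close> rare, the lower bound makes empty
  large rectangles rare. With the constant summand the total is at most 0.0144 + 3 * 0.01024, below
  1/20.\<close>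

lemma expectation_strip_weight:
  assumes P: "poisson_point_process M X n" and w: "w > 0" and nw: "25 \<le> n * w\<^sup>2" "n * w\<^sup>2 \<le> 36"
  shows "integrable M (\<lambda>\<omega>. strip_weight (X \<omega>) w r i)"
    and "(\<integral>\<omega>. strip_weight (X \<omega>) w r i \<partial>M) \<le> (if i = 0 then 2 else 1/20)"
proof -
  interpret prob_space M using P by (simp add: poisson_point_process_def)
  have meas [measurable]: "(\<lambda>\<omega>. strip_weight (X \<omega>) w r i) \<in> borel_measurable M"
    using indep_strip_weight[OF P w, of r "Suc i"] unfolding indep_vars_def by auto
  note le = strip_weight_le[of _ w r i]
  show int: "integrable M (\<lambda>\<omega>. strip_weight (X \<omega>) w r i)"
    by (rule integrable_const_bound[of _ "1 + exp (- 5)"])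
       (use meas le in \<open>auto simp: abs_of_nonneg[OF strip_weight_nonneg]\<close>)
  have [measurable]: "(\<lambda>\<omega>. card (X \<omega> \<inter> rect a b c e)) \<in> measurable M (count_space UNIV)" for a b c e
    using P bounded_rect by (simp add: poisson_point_process_def)
  have pois: "prob {\<omega> \<in> space M. card (X \<omega> \<inter> B) = k} =
      (n * measure lborel B) ^ k / fact k * exp (- (n * measure lborel B))"
    if "B \<in> sets borel" "bounded B" for B k
    using P that unfolding poisson_point_process_def by blast
  have void: "prob {\<omega> \<in> space M. card (X \<omega> \<inter> rect a b c e) = 0} = exp (- (n * ((b - a) * (e - c))))"
    if "a \<le> b" "c \<le> e" for a b c e
    using pois[OF sets_rect bounded_rect, of a b c e 0] that by (simp add: measure_rect)
  define A where "A = {\<omega> \<in> space M. card (X \<omega> \<inter> thin w i (r i)) = 0}"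
  define U where "U = {\<omega> \<in> space M. card (X \<omega> \<inter> upper w i (r i)) = 0}"
  define L where "L = {\<omega> \<in> space M. card (X \<omega> \<inter> lower w i (r i)) = 0}"
  have AUL [measurable]: "A \<in> events" "U \<in> events" "L \<in> events"
    unfolding A_def U_def L_def thin_def upper_def lower_def by measurable
  have "prob A = exp (- (n * w\<^sup>2) * 4 / 10000)"
    unfolding A_def thin_def using w by (subst void) (auto simp: field_simps power2_eq_square)
  moreover have "1 + (- (n * w\<^sup>2) * 4 / 10000) \<le> exp (- (n * w\<^sup>2) * 4 / 10000)"
    by (rule exp_ge_add_one_self)
  ultimately have pA: "1 - prob A \<le> 144 / 10000" using nw by linarith
  have "prob U = exp (- (n * w\<^sup>2) * 228 / 1000)"
    unfolding U_def upper_def using w by (subst void) (auto simp: field_simps power2_eq_square)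
  also have "\<dots> \<le> exp (- 5)" using nw by simp
  finally have pU: "prob U \<le> exp (- 5)" .
  have "prob L = exp (- (n * w\<^sup>2) * 228 / 1000)"
    unfolding L_def lower_def using w by (subst void) (auto simp: field_simps power2_eq_square)
  also have "\<dots> \<le> exp (- 5)" using nw by simp
  finally have pL: "prob L \<le> exp (- 5)" .
  show "(\<integral>\<omega>. strip_weight (X \<omega>) w r i \<partial>M) \<le> (if i = 0 then 2 else 1/20)"
  proof (cases "i = 0")
    case True
    have "(\<integral>\<omega>. strip_weight (X \<omega>) w r i \<partial>M) \<le> (\<integral>\<omega>. 1 + exp (- 5) \<partial>M)"
      by (rule integral_mono) (use int le in auto)
    then show ?thesis using True exp_neg_5_le by (simp add: prob_space)
  next
    case False
    have "(\<integral>\<omega>. strip_weight (X \<omega>) w r i \<partial>M) \<le>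
       (\<integral>\<omega>. indicator (space M - A) \<omega> + indicator U \<omega> + indicator L \<omega> + exp (- 5) \<partial>M)"
    proof (rule integral_mono[OF int])
      fix \<omega> assume "\<omega> \<in> space M"
      then show "strip_weight (X \<omega>) w r i \<le> indicator (space M - A) \<omega> + indicator U \<omega> + indicator L \<omega> + exp (- 5)"
        using False by (auto simp: strip_weight_def A_def U_def L_def indicator_def)
    qed (auto simp: emeasure_eq_measure)
    also have "\<dots> = prob (space M - A) + prob U + prob L + exp (- 5)"
      by (simp add: emeasure_eq_measure prob_space)
    also have "\<dots> \<le> 1/20"
      using pA pU pL exp_neg_5_le by (simp add: prob_compl)
    finally show ?thesis using False by simp
  qed
qed

text \<open>Encoding row sequences by their increments turns the sum over sequences into a product
  of sums over a single strip. Each is at most 10/20, except \<open>10 * 2\<close> for strip 0,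
  whence the factor 40.\<close>

lemma measure_short_path_le:
  fixes K :: nat and w :: real
  assumes P: "poisson_point_process (M :: 'w measure) X n"
    and w: "w > 0" and nw: "25 \<le> n * w\<^sup>2" "n * w\<^sup>2 \<le> 36"
    and gt: "gx t = real K * w" "gy t = 0" and K: "K > 0"
    and E: "E \<in> sets M"
    and short: "\<And>\<omega>. \<omega> \<in> E \<Longrightarrow> \<exists>Z. del_path (X \<omega> \<union> {s, t}) s t Z \<and>
                   path_len Z \<le> (1 + 2.47 / 10 ^ 11) * (K * w)"
  shows "measure M E \<le> 40 * (1/2) ^ K"
proof -
  interpret prob_space M using P by (simp add: poisson_point_process_def)
  \<comment> \<open>A finite range that holds every increment of a short path: these are at most
    \<open>1235/100000 * K + 6/5\<close>.\<close>
  define J where "J = {- int (K + 2)..int (K + 2)}"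
  define S where "S = PiE {..<K} (\<lambda>_. J)"
  have finS: "finite S" unfolding S_def J_def by (intro finite_PiE) auto
  define row where "row j i = (\<Sum>l<i. j l)" for j :: "nat \<Rightarrow> int" and i
  define a where "a j i = exp (5/4 - \<bar>real_of_int (j i)\<bar>)" for j :: "nat \<Rightarrow> int" and i :: nat
  define N where "N \<omega> = (\<Sum>j\<in>S. (\<Prod>i<K. a j i) * (\<Prod>i<K. strip_weight (X \<omega>) w (row j) i))" for \<omega>
  define b where "b i = (if i = 0 then 2 else 1/20 :: real)" for i :: nat
  have pos: "0 \<le> a j i" for j i by (simp add: a_def)
  have integrable_prod: "integrable M (\<lambda>\<omega>. \<Prod>i<K. strip_weight (X \<omega>) w r i)" for r
    by (rule indep_vars_integrable)
       (auto intro: indep_strip_weight[OF P w] expectation_strip_weight[OF P w nw])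
  have integral_prod: "(\<integral>\<omega>. (\<Prod>i<K. strip_weight (X \<omega>) w r i) \<partial>M) \<le> (\<Prod>i<K. b i)" for r
  proof -
    have "(\<integral>\<omega>. (\<Prod>i<K. strip_weight (X \<omega>) w r i) \<partial>M) = (\<Prod>i<K. \<integral>\<omega>. strip_weight (X \<omega>) w r i \<partial>M)"
      by (rule indep_vars_lebesgue_integral)
         (auto intro: indep_strip_weight[OF P w] expectation_strip_weight[OF P w nw])
    also have "\<dots> \<le> (\<Prod>i<K. b i)"
      unfolding b_def using expectation_strip_weight(2)[OF P w nw]
      by (intro prod_mono) (auto intro!: Bochner_Integration.integral_nonneg strip_weight_nonneg)
    finally show ?thesis .
  qed
  have intN: "integrable M N"
    unfolding N_def by (intro Bochner_Integration.integrable_sum integrable_mult_right integrable_prod)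
  have N1: "1 \<le> N \<omega>" if \<omega>: "\<omega> \<in> E" for \<omega>
  proof -
    have sp: "\<omega> \<in> space M" using \<omega> E sets.sets_into_space by blast
    have lf: "locally_finite (X \<omega>)" using P sp by (simp add: poisson_point_process_def)
    obtain Z where Z: "del_path (X \<omega> \<union> {s, t}) s t Z" "path_len Z \<le> (1 + 2.47 / 10 ^ 11) * (K * w)"
      using short[OF \<omega>] by blast
    obtain r c where r: "r 0 = 0" "\<And>i. i < K \<Longrightarrow> 0 \<le> c i" "\<And>i. i < K \<Longrightarrow> \<bar>r (Suc i) - r i\<bar> \<le> c i + 6/5"
      "(\<Sum>i<K. c i) \<le> 1235/100000 * K"
      "\<And>i. 0 < i \<Longrightarrow> i < K \<Longrightarrow> c i < 5 \<Longrightarrow> good (X \<omega>) w i (r i)"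
      by (rule cheap_path_rows[OF Z(1) gt w K Z(2)]) (rule that)
    define j where "j = restrict (\<lambda>i. r (Suc i) - r i) {..<K}"
    have row: "row j i = r i" if "i \<le> K" for i
      using that r(1) by (induction i) (auto simp: row_def j_def)
    have "j \<in> S"
    proof -
      have "\<bar>r (Suc i) - r i\<bar> \<le> int (K + 2)" if i: "i < K" for i
      proof -
        have "c i \<le> (\<Sum>i<K. c i)" using i r(2) by (intro member_le_sum) auto
        then have "\<bar>r (Suc i) - r i\<bar> \<le> real (K + 2)" using r(3)[OF i] r(4) by simp
        then show ?thesis by linarith
      qed
      then show ?thesis by (fastforce simp: S_def J_def j_def abs_le_iff)
    qed
    \<comment> \<open>One factor \<open>exp (- c i)\<close> pays for the increment, the other for
      the strip weight. The surplus is 5/4 - 6/5 = 1/20.\<close>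
    have step: "exp (1/20) * exp (- 2 * c i) \<le> a j i * strip_weight (X \<omega>) w (row j) i" if i: "i < K" for i
    proof -
      have "exp (1/20 - c i) \<le> a j i"
        using r(3)[OF i] i by (simp add: a_def j_def)
      moreover have "exp (- c i) \<le> strip_weight (X \<omega>) w (row j) i"
      proof (cases "i = 0 \<or> c i < 5")
        case True
        \<comment> \<open>Finiteness makes \<open>card\<close> vanish only on the empty set, as
          needed for a point in \<open>thin\<close> to count.\<close>
        have fin: "finite (X \<omega> \<inter> rect a b c e)" for a b c e
          using lf bounded_rect by (simp add: locally_finite_def)
        have "i = 0 \<or> good (X \<omega>) w i (r i)" using True r(5) i by blast
        then have "1 \<le> strip_weight (X \<omega>) w (row j) i"
          using fin i unfolding strip_weight_def good_def thin_def upper_def lower_def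
          by (auto simp: row)
        moreover have "exp (- c i) \<le> 1" using r(2)[OF i] by simp
        ultimately show ?thesis by linarith
      next
        case False
        then have "exp (- c i) \<le> exp (- 5)" by simp
        also have "\<dots> \<le> strip_weight (X \<omega>) w (row j) i" by (rule exp_neg_5_le_strip_weight)
        finally show ?thesis .
      qed
      ultimately have "exp (1/20 - c i) * exp (- c i) \<le> a j i * strip_weight (X \<omega>) w (row j) i"
        using pos[of j i] by (intro mult_mono) (assumption | rule exp_ge_zero)+
      moreover have "exp (1/20) * exp (- 2 * c i) = exp (1/20 - c i) * exp (- c i)"
        unfolding exp_add[symmetric] by (rule arg_cong[where f=exp]) simp
      ultimately show ?thesis by (simp only:)
    qed
    have "(\<Sum>i<K. 1/20 + - 2 * c i) = K / 20 - 2 * (\<Sum>i<K. c i)"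
      by (simp add: sum_subtractf sum_distrib_left)
    \<comment> \<open>The exponent is nonnegative because
      \<open>2 * 1235/100000 \<le> 1/20\<close>.\<close>
    then have "1 \<le> exp (\<Sum>i<K. 1/20 + - 2 * c i)"
      using r(4) by simp
    also have "\<dots> = (\<Prod>i<K. exp (1/20) * exp (- 2 * c i))"
      by (subst exp_sum) (simp_all only: exp_add finite_lessThan)
    also have "\<dots> \<le> (\<Prod>i<K. a j i * strip_weight (X \<omega>) w (row j) i)"
      using step by (intro prod_mono) auto
    also have "\<dots> = (\<Prod>i<K. a j i) * (\<Prod>i<K. strip_weight (X \<omega>) w (row j) i)"
      by (rule prod.distrib)
    also have "\<dots> \<le> N \<omega>"
      unfolding N_def using \<open>j \<in> S\<close> finS
      by (intro member_le_sum[of j S "\<lambda>j. (\<Prod>i<K. a j i) * (\<Prod>i<K. strip_weight (X \<omega>) w (row j) i)"])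
         (auto intro!: mult_nonneg_nonneg prod_nonneg pos strip_weight_nonneg)
    finally show ?thesis .
  qed
  have N0: "0 \<le> N \<omega>" for \<omega>
    unfolding N_def by (auto intro!: sum_nonneg mult_nonneg_nonneg prod_nonneg pos strip_weight_nonneg)
  have "measure M E = (\<integral>\<omega>. indicator E \<omega> \<partial>M)" using E by simp
  also have "\<dots> \<le> (\<integral>\<omega>. N \<omega> \<partial>M)"
  proof (rule integral_mono[OF _ intN])
    show "integrable M (indicator E :: 'w \<Rightarrow> real)"
      using E by (simp add: emeasure_eq_measure)
    show "indicator E \<omega> \<le> N \<omega>" for \<omega>
      using N0[of \<omega>] N1[of \<omega>] by (cases "\<omega> \<in> E") simp_all
  qed
  also have "\<dots> = (\<Sum>j\<in>S. (\<Prod>i<K. a j i) * (\<integral>\<omega>. (\<Prod>i<K. strip_weight (X \<omega>) w (row j) i) \<partial>M))"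
    unfolding N_def
    by (simp only: Bochner_Integration.integral_sum[OF integrable_mult_right[OF integrable_prod]]
          integral_mult_right_zero)
  also have "\<dots> \<le> (\<Sum>j\<in>S. (\<Prod>i<K. a j i) * (\<Prod>i<K. b i))"
    by (intro sum_mono mult_left_mono integral_prod prod_nonneg pos)
  also have "\<dots> = (\<Sum>j\<in>S. \<Prod>i<K. exp (5/4 - \<bar>real_of_int (j i)\<bar>) * b i)"
    unfolding a_def prod.distrib by (rule refl)
  also have "\<dots> = (\<Prod>i<K. \<Sum>y\<in>J. exp (5/4 - \<bar>real_of_int y\<bar>) * b i)"
    unfolding S_def J_def by (rule prod_sum_PiE[symmetric]) auto
  also have "\<dots> \<le> (\<Prod>i<K. if i = 0 then 20 else 1/2)"
  proof (rule prod_mono)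
    fix i
    have "(\<Sum>y\<in>J. exp (5/4 - \<bar>real_of_int y\<bar>)) * b i \<le> 10 * b i"
      unfolding J_def by (rule mult_right_mono[OF sum_exp_abs_le]) (simp add: b_def)
    also have "10 * b i = (if i = 0 then 20 else 1/2)" by (simp add: b_def)
    finally have "(\<Sum>y\<in>J. exp (5/4 - \<bar>real_of_int y\<bar>) * b i) \<le> (if i = 0 then 20 else 1/2)"
      by (simp only: sum_distrib_right)
    moreover have "0 \<le> b i" by (simp add: b_def)
    then have "0 \<le> (\<Sum>y\<in>J. exp (5/4 - \<bar>real_of_int y\<bar>) * b i)"
      by (intro sum_nonneg mult_nonneg_nonneg exp_ge_zero)
    ultimately show "0 \<le> (\<Sum>y\<in>J. exp (5/4 - \<bar>real_of_int y\<bar>) * b i) \<and>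
       (\<Sum>y\<in>J. exp (5/4 - \<bar>real_of_int y\<bar>) * b i) \<le> (if i = 0 then 20 else 1/2)"
      by blast
  qed
  also have "\<dots> = 40 * (1/2) ^ K"
  proof -
    obtain K' where K': "K = Suc K'" using K by (cases K) auto
    show ?thesis unfolding K' prod.lessThan_Suc_shift by simp
  qed
  finally show ?thesis .
qed

end

section \<open>Choice of the number of strips\<close>

theorem theorem1:
  fixes s t :: "real^2"
    and M :: "real \<Rightarrow> 'w measure"
    and X :: "real \<Rightarrow> 'w \<Rightarrow> (real^2) set"
  assumes "s \<noteq> t"
    and "\<And>n. n > 0 \<Longrightarrow> poisson_point_process (M n) (X n) n"
  shows "let E = (\<lambda>n. {\<omega> \<in> space (M n). \<exists>Z. shortest_path (X n \<omega> \<union> {s, t}) s t Z \<and>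
                        path_len Z \<le> (1 + 2.47 / 10 ^ 11) * norm (s - t)})
         in (\<forall>n>0. E n \<in> sets (M n)) \<and>
            (\<lambda>n. measure (M n) (E n)) \<in> O[at_top](\<lambda>n. n powr (-1/2))"
proof -
  define d where "d = norm (s - t)"
  have d: "d > 0" using assms(1) by (simp add: d_def)
  define E where "E n = {\<omega> \<in> space (M n). \<exists>Z. shortest_path (X n \<omega> \<union> {s, t}) s t Z \<and>
                        path_len Z \<le> (1 + 2.47 / 10 ^ 11) * d}" for n
  have E_sets: "E n \<in> sets (M n)" if "n > 0" for n
    unfolding E_def using assms(2)[OF that]
    by (intro sets_ex_shortest_path_le) (auto simp: poisson_point_process_def)
  have "norm (t - s) = norm (vector [d, 0] :: real^2)"
    using d by (simp add: d_def power2_commute norm_vec_def L2_set_def sum_2)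
  then obtain T where T: "orthogonal_transformation T" "T (t - s) = (vector [d, 0] :: real^2)"
    using orthogonal_transformation_exists by metis
  interpret frame T s by unfold_locales (rule T)
  have gt: "gx t = d" "gy t = 0" by (simp_all add: gx_def gy_def T)
  have bound: "measure (M n) (E n) \<le> (200 / d) * n powr (-1/2)" if n: "n \<ge> (25 / d)\<^sup>2" for n
  proof -
    have n0: "n > 0" using n d by (smt (verit) divide_pos_pos zero_less_power)
    \<comment> \<open>The number of strips of width \<open>5 / sqrt n\<close>, not yet an integer.
      Rounding down widens the strips by a factor of at most 6/5 because \<open>y \<ge> 5\<close>,
      which the threshold on \<open>n\<close> ensures; hence the window from 25 to 36.\<close>
    define y where "y = d * sqrt n / 5"
    have "25 / d \<le> sqrt n" using n by (rule real_le_rsqrt)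
    then have y5: "5 \<le> y" using d by (simp add: y_def field_simps)
    define K where "K = nat \<lfloor>y\<rfloor>"
    have K: "K \<le> y" "y < K + 1" using y5 unfolding K_def by linarith+
    have K5: "5 \<le> K" using y5 unfolding K_def by linarith
    define w where "w = d / K"
    have w: "w > 0" using d K5 by (simp add: w_def)
    have Kw: "K * w = d" using K5 by (simp add: w_def)
    have sw: "sqrt n * w = 5 * (y / K)" using d by (simp add: y_def w_def)
    have "1 \<le> y / K" "y / K \<le> 6 / 5" using K K5 by (auto simp: field_simps)
    then have "5 \<le> sqrt n * w" "sqrt n * w \<le> 6" unfolding sw by linarith+
    then have "5\<^sup>2 \<le> (sqrt n * w)\<^sup>2" "(sqrt n * w)\<^sup>2 \<le> 6\<^sup>2"
      by (intro power_mono; simp)+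
    then have nw: "25 \<le> n * w\<^sup>2" "n * w\<^sup>2 \<le> 36" using n0 by (auto simp: power_mult_distrib)
    have "measure (M n) (E n) \<le> 40 * (1/2) ^ K"
    proof (rule measure_short_path_le[OF assms(2)[OF n0] w nw])
      fix \<omega> assume "\<omega> \<in> E n"
      then show "\<exists>Z. del_path (X n \<omega> \<union> {s, t}) s t Z \<and> path_len Z \<le> (1 + 2.47 / 10 ^ 11) * (K * w)"
        unfolding E_def Kw by (auto simp: shortest_path_def is_arg_min_def)
    qed (use gt Kw K5 E_sets n0 in auto)
    \<comment> \<open>Here the exponential decay in \<open>sqrt n\<close> is given up:
      \<open>2 ^ K \<ge> K + 1 > y\<close> is enough for the claimed rate.\<close>
    also have "(1/2 :: real) ^ K \<le> 1 / y"
    proof -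
      have "Suc K \<le> 2 ^ K" by (rule Suc_leI[OF less_exp])
      then have "real (Suc K) \<le> real (2 ^ K)" by (simp only: of_nat_le_iff)
      then have "y \<le> 2 ^ K" using K(2) by simp
      then show ?thesis using y5 by (simp add: power_divide frac_le)
    qed
    also have "40 * (1 / y) = (200 / d) * n powr (-1/2)"
      using n0 d by (simp add: y_def powr_minus powr_half_sqrt field_simps)
    finally show ?thesis by simp
  qed
  have "(\<lambda>n. measure (M n) (E n)) \<in> O[at_top](\<lambda>n. n powr (-1/2))"
  proof (rule bigoI)
    show "\<forall>\<^sub>F n in at_top. norm (measure (M n) (E n)) \<le> (200 / d) * norm (n powr (-1/2))"
      using eventually_ge_at_top[of "(25 / d)\<^sup>2"] by eventually_elim (use bound in auto)
  qed
  then show ?thesis using E_sets by (simp add: E_def d_def Let_def)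
qed

end
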